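(* Let $E_{2,4}(x_1,x_2,x_3,x_4)=x_1x_2+x_1x_3+x_1x_4+x_2x_3+x_2x_4+x_3x_4$ and let $\beta$ be real. The function $E_{2,4}^{-\beta}$ is completely monotone on $(0,\infty)^4$ if and only if $\beta=0$ or $\beta\ge 1$. In particular, the function $$\Bigl(\sum_{1\le i<j\le 4}(1-y_i)(1-y_j)\Bigr)^{-\beta}$$ has nonnegative Taylor coefficients (in $y_1,\ldots,y_4$, around the origin) for all $\beta\ge 1$.
   Context: A $C^\infty$ function $f$ on $(0,\infty)^n$ is completely monotone if $(-1)^k\,\partial^kf/\partial x_{i_1}\cdots\partial x_{i_k}\ge 0$ everywhere on $(0,\infty)^n$ for all $k\ge 0$ and all indices $i_1,\ldots,i_k$. *)

theory Defs
  imports "HOL-Analysis.Analysis"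
begin

definition partial_deriv :: "'n \<Rightarrow> (real^'n::finite \<Rightarrow> real) \<Rightarrow> real^'n \<Rightarrow> real" where
  "partial_deriv i f x = deriv (\<lambda>t. f (x + t *\<^sub>R axis i 1)) 0"

text \<open>\<open>iter_partial [i\<^sub>1, \<dots>, i\<^sub>k] f\<close> is \<open>\<partial>\<^sup>k f / \<partial>x\<^bsub>i\<^sub>1\<^esub> \<cdots> \<partial>x\<^bsub>i\<^sub>k\<^esub>\<close>. At points of an open set on which \<open>f\<close> is
  smooth it only depends on \<open>f\<close> on that set.\<close>

definition iter_partial :: "'n list \<Rightarrow> (real^'n::finite \<Rightarrow> real) \<Rightarrow> real^'n \<Rightarrow> real" where
  "iter_partial is f = foldr partial_deriv is f"

text \<open>\<open>C\<^sup>\<infinity>\<close> on \<open>S\<close> (meant for open \<open>S\<close>): the partial derivatives of all orders exist and are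
  continuous on \<open>S\<close>. The existence clause is needed because \<^const>\<open>deriv\<close> is total.\<close>

definition smooth_on_open :: "(real^'n::finite) set \<Rightarrow> (real^'n \<Rightarrow> real) \<Rightarrow> bool" where
  "smooth_on_open S f \<longleftrightarrow>
     (\<forall>is. continuous_on S (iter_partial is f) \<and>
           (\<forall>i. \<forall>x\<in>S. (\<lambda>t. iter_partial is f (x + t *\<^sub>R axis i 1)) differentiable (at 0)))"

definition pos_orthant :: "(real^'n::finite) set" where
  "pos_orthant = {x. \<forall>i. x $ i > 0}"

definition completely_monotone :: "(real^'n::finite \<Rightarrow> real) \<Rightarrow> bool" where
  "completely_monotone f \<longleftrightarrow>
     smooth_on_open pos_orthant f \<and>
     (\<forall>is. \<forall>x\<in>pos_orthant. (-1) ^ length is * iter_partial is f x \<ge> 0)"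

text \<open>The coefficient of \<open>\<Prod>\<^sub>i (y\<^sub>i - a\<^sub>i)\<^bsup>\<alpha> i\<^esup>\<close>, i.e. \<open>\<partial>\<^sup>\<alpha> f(a) / \<alpha>!\<close>. The variables are
  taken in increasing order of the index type; for \<open>f\<close> smooth near \<open>a\<close> the order is irrelevant.\<close>

definition taylor_coeff ::
    "(real^('n::{finite,linorder}) \<Rightarrow> real) \<Rightarrow> real^('n::{finite,linorder}) \<Rightarrow> ('n \<Rightarrow> nat) \<Rightarrow> real" where
  "taylor_coeff f a \<alpha> =
     iter_partial (concat (map (\<lambda>i. replicate (\<alpha> i) i) (sorted_list_of_set UNIV))) f a
       / (\<Prod>i\<in>UNIV. fact (\<alpha> i))"

text \<open>The smoothness clause makes the Taylor coefficients meaningful.\<close>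

definition nonneg_taylor_coeffs ::
    "(real^('n::{finite,linorder}) \<Rightarrow> real) \<Rightarrow> real^('n::{finite,linorder}) \<Rightarrow> bool" where
  "nonneg_taylor_coeffs f a \<longleftrightarrow>
     (\<exists>U. open U \<and> a \<in> U \<and> smooth_on_open U f) \<and> (\<forall>\<alpha>. taylor_coeff f a \<alpha> \<ge> 0)"

text \<open>In the index type \<open>4\<close> the numeral \<open>4\<close> equals \<open>0\<close>, so \<open>1, 2, 3, 4\<close> are its four distinct
  elements.\<close>

definition E24 :: "real^4 \<Rightarrow> real" where
  "E24 x = x$1 * x$2 + x$1 * x$3 + x$1 * x$4 + x$2 * x$3 + x$2 * x$4 + x$3 * x$4"

end

theory Submission
  imports Defs "HOL-Probability.Sinc_Integral"
begin

text \<open>For \<open>\<beta> \<ge> 1\<close>, put \<open>s = x\<^sub>1 + x\<^sub>2 + x\<^sub>3\<close> and let \<open>q\<^sub>1, q\<^sub>2, q\<^sub>3\<close> be the vertices of an equilateral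
  triangle with unit sides in the plane. The linear form
  \<open>l\<^sub>v(x) = x\<^sub>4 + \<Sum>\<^sub>i\<^sub>\<le>\<^sub>3 x\<^sub>i |v - q\<^sub>i|\<^sup>2\<close> equals \<open>s |v - w|\<^sup>2 + E(x) / s\<close> for some \<open>w\<close>, so a rescaling of \<open>v\<close> shows
  that \<open>\<integral> l\<^sub>v(x) powr - (\<beta> + 1) dv\<close> is a constant multiple of \<open>s powr (\<beta> - 1) * E(x) powr - \<beta>\<close>. Hence
  \<open>E powr - \<beta>\<close> is the product of \<open>s powr - (\<beta> - 1)\<close> and a mixture of negative powers of linear forms
  with nonnegative coefficients.

  For \<open>0 < \<beta> < 1\<close>, the operator \<open>R = (\<Sum>\<^sub>i \<partial>\<^sub>i)\<^sup>2 - 3 \<Sum>\<^sub>i \<partial>\<^sub>i\<^sup>2\<close> satisfies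
  \<open>R E\<^sup>-\<^sup>\<beta> = 6 \<beta> (\<beta> - 1) E\<^sup>-\<^sup>\<beta>\<^sup>-\<^sup>1\<close>, whence \<open>R\<^sup>2 E\<^sup>-\<^sup>\<beta>\<close> is negative. If \<open>E\<^sup>-\<^sup>\<beta>\<close> were a Laplace transform of a
  positive measure, \<open>R\<^sup>2 E\<^sup>-\<^sup>\<beta>\<close> would be an integral of a square. To avoid Bernstein's theorem,
  \<open>R\<^sup>2\<close> is multiplied by a high power of \<open>G = (\<Sum>\<^sub>i \<partial>\<^sub>i)\<^sup>2\<close>: up to a correction of relative order \<open>1 / n\<close>,
  \<open>R\<^sup>2 G\<^sup>n\<close> has nonnegative coefficients. By homogeneity, \<open>G\<^sup>n\<close> does not change signs on the diagonal.\<close>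

section \<open>Iterated partial derivatives\<close>

lemma iter_partial_Cons: "iter_partial (i # is) f = partial_deriv i (iter_partial is f)"
  by (simp add: iter_partial_def)

lemma iter_partial_Nil: "iter_partial [] f = f"
  by (simp add: iter_partial_def)

lemma iter_partial_append: "iter_partial (is @ js) f = iter_partial is (iter_partial js f)"
  by (simp add: iter_partial_def)

lemma open_pos_orthant: "open (pos_orthant :: (real^'n::finite) set)"
proof -
  have eq: "pos_orthant = (\<Inter>i\<in>UNIV. {x :: real^'n. 0 < x $ i})"
    by (auto simp: pos_orthant_def)
  show ?thesis
    unfolding eq by (intro open_INT ballI open_Collect_less continuous_intros) simp
qed

lemma pos_orthantD: "x \<in> pos_orthant \<Longrightarrow> 0 < x $ i"
  by (simp add: pos_orthant_def)

lemma eventually_along: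
  fixes x :: "real^'n::finite"
  assumes "open S" "x \<in> S"
  shows "\<forall>\<^sub>F t in nhds 0. x + t *\<^sub>R v \<in> S"
proof -
  have "((\<lambda>t. x + t *\<^sub>R v) \<longlongrightarrow> x + 0 *\<^sub>R v) (nhds 0)"
    by (intro tendsto_intros filterlim_ident)
  then show ?thesis
    using assms by (auto simp: tendsto_def)
qed

lemma partial_deriv_cong:
  fixes f :: "real^'n::finite \<Rightarrow> real"
  assumes "open S" "x \<in> S" "\<And>y. y \<in> S \<Longrightarrow> f y = g y"
  shows "partial_deriv i f x = partial_deriv i g x"
  unfolding partial_deriv_def
  using eventually_along[OF assms(1,2), of "axis i 1"]
  by (intro deriv_cong_ev) (auto elim!: eventually_mono intro: assms(3))

lemma partial_deriv_eqI:
  fixes f :: "real^'n::finite \<Rightarrow> real"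
  assumes "((\<lambda>t. f (x + t *\<^sub>R axis i 1)) has_real_derivative d) (at 0)"
  shows "partial_deriv i f x = d"
  unfolding partial_deriv_def using assms by (rule DERIV_imp_deriv)

lemma iter_partial_cong:
  fixes f :: "real^'n::finite \<Rightarrow> real"
  assumes "open S" "\<And>y. y \<in> S \<Longrightarrow> f y = g y" "x \<in> S"
  shows "iter_partial is f x = iter_partial is g x"
  using assms(3)
proof (induction "is" arbitrary: x)
  case (Cons i js)
  then show ?case
    unfolding iter_partial_Cons by (intro partial_deriv_cong[OF assms(1)]) auto
qed (simp add: iter_partial_Nil assms(2))

lemma has_derivative_along_cong:
  fixes f :: "real^'n::finite \<Rightarrow> real"
  assumes "open S" "x \<in> S" "\<And>y. y \<in> S \<Longrightarrow> f y = g y"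
    and "((\<lambda>t. g (x + t *\<^sub>R v)) has_real_derivative d) (at 0)"
  shows "((\<lambda>t. f (x + t *\<^sub>R v)) has_real_derivative d) (at 0)"
proof -
  have "\<forall>\<^sub>F t in nhds 0. f (x + t *\<^sub>R v) = g (x + t *\<^sub>R v)"
    using eventually_along[OF assms(1,2)] by eventually_elim (rule assms(3))
  then show ?thesis
    using DERIV_cong_ev[of 0 0 "\<lambda>t. f (x + t *\<^sub>R v)" "\<lambda>t. g (x + t *\<^sub>R v)" d d] assms(4) by simp
qed

lemma smooth_on_open_cong:
  fixes f :: "real^'n::finite \<Rightarrow> real"
  assumes S: "open S" and eq: "\<And>y. y \<in> S \<Longrightarrow> f y = g y" and g: "smooth_on_open S g"
  shows "smooth_on_open S f"
  unfolding smooth_on_open_def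
proof (intro allI conjI ballI)
  fix "is"
  have e: "iter_partial is f y = iter_partial is g y" if "y \<in> S" for y
    using iter_partial_cong[OF S eq that] .
  show "continuous_on S (iter_partial is f)"
    using g e by (simp add: smooth_on_open_def cong: continuous_on_cong)
  fix i x assume x: "x \<in> S"
  have "(\<lambda>t. iter_partial is g (x + t *\<^sub>R axis i 1)) differentiable (at 0)"
    using g x by (simp add: smooth_on_open_def)
  then show "(\<lambda>t. iter_partial is f (x + t *\<^sub>R axis i 1)) differentiable (at 0)"
    unfolding real_differentiable_def
    by (blast intro: has_derivative_along_cong[OF S x, of "iter_partial is f" "iter_partial is g"] e)
qed

lemma completely_monotone_cong:
  fixes f :: "real^'n::finite \<Rightarrow> real"
  assumes eq: "\<And>y. y \<in> pos_orthant \<Longrightarrow> f y = g y" and g: "completely_monotone g"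
  shows "completely_monotone f"
proof -
  have "smooth_on_open pos_orthant f"
    using g by (intro smooth_on_open_cong[OF open_pos_orthant eq]) (simp_all add: completely_monotone_def)
  moreover have "iter_partial is f x = iter_partial is g x" if "x \<in> pos_orthant" for "is" x
    by (rule iter_partial_cong[OF open_pos_orthant eq that])
  ultimately show ?thesis
    using g by (simp add: completely_monotone_def)
qed

lemma smooth_has_derivative_along:
  fixes f :: "real^'n::finite \<Rightarrow> real"
  assumes "smooth_on_open S f" "x \<in> S"
  shows "((\<lambda>t. iter_partial is f (x + t *\<^sub>R axis i 1)) has_real_derivative
           iter_partial (i # is) f x) (at 0)"
  using assms
  unfolding smooth_on_open_def iter_partial_Cons partial_deriv_def[abs_def]
  by (auto simp: DERIV_deriv_iff_real_differentiable)

lemma smooth_iter_partial: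
  assumes "smooth_on_open S f"
  shows "smooth_on_open S (iter_partial is f)"
  using assms unfolding smooth_on_open_def iter_partial_append[symmetric] by blast

lemma has_derivative_along_shift:
  fixes f :: "real^'n::finite \<Rightarrow> real"
  assumes "((\<lambda>t. f ((x + t0 *\<^sub>R v) + t *\<^sub>R v)) has_real_derivative d) (at 0)"
  shows "((\<lambda>t. f (x + t *\<^sub>R v)) has_real_derivative d) (at t0)"
  using assms DERIV_shift[of "\<lambda>t. f (x + t *\<^sub>R v)" d 0 t0]
  by (simp add: algebra_simps)

text \<open>Telescoping over the coordinates reduces differentiability to the mean value theorem in
  each coordinate direction.\<close>

lemma has_derivative_partials:
  fixes f :: "real^'n::finite \<Rightarrow> real"
  assumes S: "open S" and x: "x \<in> S"
    and der: "\<And>i y. y \<in> S \<Longrightarrow> ((\<lambda>t. f (y + t *\<^sub>R axis i 1)) has_real_derivative f' i y) (at 0)"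
    and cont: "\<And>i. continuous_on S (f' i)"
  shows "(f has_derivative (\<lambda>h. \<Sum>i\<in>UNIV. h $ i * f' i x)) (at x)"
proof (unfold has_derivative_within_alt, intro conjI allI impI)
  show "bounded_linear (\<lambda>h. \<Sum>i\<in>UNIV. h $ i * f' i x)"
    by (intro bounded_linear_sum bounded_linear_mult_left[THEN bounded_linear_compose]
        bounded_linear_vec_nth)
  fix e :: real assume e: "0 < e"
  define n where "n = real CARD('n)"
  \<comment> \<open>Each of the \<open>n\<close> coordinates may contribute an error of
    \<open>e' * norm h\<close>, which adds up to \<open>e * norm h\<close>.\<close>
  define e' where "e' = e / n"
  have n: "0 < n" and e': "0 < e'" using e by (auto simp: n_def e'_def)
  have "\<forall>\<^sub>F y in nhds x. \<forall>i. y \<in> S \<and> \<bar>f' i y - f' i x\<bar> < e'"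
  proof (rule eventually_all_finite)
    fix i
    have "(f' i \<longlongrightarrow> f' i x) (nhds x)"
      using cont[of i] S x by (simp add: continuous_on_eq_continuous_at isCont_def tendsto_at_iff_tendsto_nhds)
    then have "\<forall>\<^sub>F y in nhds x. dist (f' i y) (f' i x) < e'"
      using e' by (rule tendstoD)
    then show "\<forall>\<^sub>F y in nhds x. y \<in> S \<and> \<bar>f' i y - f' i x\<bar> < e'"
      using eventually_nhds_in_open[OF S x] by eventually_elim (simp add: dist_real_def)
  qed
  then obtain d where d: "0 < d" and
    near: "\<And>y i. dist y x < d \<Longrightarrow> y \<in> S \<and> \<bar>f' i y - f' i x\<bar> < e'"
    unfolding eventually_nhds_metric by blast
  show "\<exists>d>0. \<forall>y\<in>UNIV. norm (y - x) < d \<longrightarrow>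
          norm (f y - f x - (\<Sum>i\<in>UNIV. (y - x) $ i * f' i x)) \<le> e * norm (y - x)"
  proof (intro exI conjI ballI impI, rule d)
    fix y assume y: "norm (y - x) < d"
    define h where "h = y - x"
    \<comment> \<open>Changing one coordinate at a time, \<open>x + trunc A\<close> runs from
      \<open>x\<close> (for \<open>A = {}\<close>) to \<open>y\<close> (for
      \<open>A = UNIV\<close>).\<close>
    define trunc where "trunc A = (\<chi> i. if i \<in> A then h $ i else 0)" for A
    have "\<bar>f (x + trunc A) - f x - (\<Sum>i\<in>A. h $ i * f' i x)\<bar> \<le> (\<Sum>i\<in>A. e' * \<bar>h $ i\<bar>)"
      if "finite A" for A
      using that
    proof (induction A)
      case empty
      have "trunc {} = 0" by (simp add: trunc_def vec_eq_iff)
      then show ?case by simp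
    next
      case (insert i A)
      define z where "z = x + trunc A"
      \<comment> \<open>Subtracting the linear term makes the derivative of \<open>\<psi>\<close> a
        difference of values of \<open>f' i\<close> near \<open>x\<close>, which is at most
        \<open>e'\<close> in absolute value.\<close>
      define \<psi> where "\<psi> t = f (z + t *\<^sub>R axis i 1) - t * f' i x" for t
      have tr: "trunc (insert i A) = trunc A + (h $ i) *\<^sub>R axis i 1"
        using insert.hyps by (auto simp: trunc_def vec_eq_iff axis_def)
      have zin: "dist (z + t *\<^sub>R axis i 1) x < d" if "\<bar>t\<bar> \<le> \<bar>h $ i\<bar>" for t
      proof -
        have "norm (trunc A + t *\<^sub>R axis i 1) \<le> norm h"
          using insert.hyps that by (intro norm_le_componentwise_cart) (auto simp: trunc_def axis_def)
        then show ?thesis using y by (simp add: z_def dist_norm h_def)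
      qed
      have der\<psi>: "(\<psi> has_real_derivative f' i (z + t *\<^sub>R axis i 1) - f' i x) (at t)"
        if "\<bar>t\<bar> \<le> \<bar>h $ i\<bar>" for t
      proof -
        have "((\<lambda>t. f (z + t *\<^sub>R axis i 1)) has_real_derivative f' i (z + t *\<^sub>R axis i 1)) (at t)"
          using near[OF zin[OF that]] by (intro has_derivative_along_shift[OF der]) blast
        then show ?thesis
          unfolding \<psi>_def by (rule DERIV_diff) (auto intro!: derivative_eq_intros)
      qed
      have "norm (\<psi> (h $ i) - \<psi> 0) \<le> e' * norm (h $ i - 0)"
      proof (rule field_differentiable_bound)
        show "convex (closed_segment 0 (h $ i))" by simp
        fix t assume "t \<in> closed_segment 0 (h $ i)"
        then have t: "\<bar>t\<bar> \<le> \<bar>h $ i\<bar>"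
          by (auto simp: closed_segment_eq_real_ivl split: if_splits)
        show "(\<psi> has_field_derivative f' i (z + t *\<^sub>R axis i 1) - f' i x)
                (at t within closed_segment 0 (h $ i))"
          using der\<psi>[OF t] by (rule has_field_derivative_at_within)
        show "norm (f' i (z + t *\<^sub>R axis i 1) - f' i x) \<le> e'"
          using near[OF zin[OF t], of i] by simp
      qed auto
      then have "\<bar>f (x + trunc (insert i A)) - f (x + trunc A) - h $ i * f' i x\<bar> \<le> e' * \<bar>h $ i\<bar>"
        by (simp add: \<psi>_def z_def tr add.assoc algebra_simps)
      with insert show ?case by simp
    qed
    from this[of UNIV] have "\<bar>f (x + trunc UNIV) - f x - (\<Sum>i\<in>UNIV. h $ i * f' i x)\<bar>
        \<le> (\<Sum>i\<in>UNIV. e' * \<bar>h $ i\<bar>)" by simp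
    also have "\<dots> \<le> (\<Sum>i\<in>(UNIV :: 'n set). e' * norm h)"
      using e' by (intro sum_mono mult_left_mono component_le_norm_cart) auto
    also have "\<dots> = e * norm h" using n by (simp add: e'_def n_def)
    finally have "\<bar>f (x + trunc UNIV) - f x - (\<Sum>i\<in>UNIV. h $ i * f' i x)\<bar> \<le> e * norm h" .
    moreover have "trunc UNIV = h" by (simp add: trunc_def vec_eq_iff)
    ultimately show "norm (f y - f x - (\<Sum>i\<in>UNIV. (y - x) $ i * f' i x)) \<le> e * norm (y - x)"
      by (simp add: h_def)
  qed
qed

section \<open>Symmetry of mixed partial derivatives\<close>

text \<open>The mean value theorem is applied twice: along \<open>i\<close> to a difference in
  direction \<open>j\<close>, then along \<open>j\<close> to the first partial derivative. The last
  index of a list acts first, so \<open>[j, i]\<close> differentiates in \<open>i\<close> before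
  \<open>j\<close>.\<close>

lemma second_difference:
  fixes f :: "real^'n::finite \<Rightarrow> real"
  assumes h: "0 < h"
    and box: "\<And>s t. \<bar>s\<bar> \<le> h \<Longrightarrow> \<bar>t\<bar> \<le> h \<Longrightarrow> x + s *\<^sub>R axis i 1 + t *\<^sub>R axis j 1 \<in> S"
    and f: "smooth_on_open S f"
  shows "\<exists>s t. 0 < s \<and> s < h \<and> 0 < t \<and> t < h \<and>
    f (x + h *\<^sub>R axis i 1 + h *\<^sub>R axis j 1) - f (x + h *\<^sub>R axis i 1) - f (x + h *\<^sub>R axis j 1) + f x
      = h\<^sup>2 * iter_partial [j, i] f (x + s *\<^sub>R axis i 1 + t *\<^sub>R axis j 1)"
proof -
  define a b :: "real^'n" where "a = axis i 1" and "b = axis j 1"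
  have box': "x + s *\<^sub>R a + t *\<^sub>R b \<in> S" if "\<bar>s\<bar> \<le> h" "\<bar>t\<bar> \<le> h" for s t
    using box[OF that] by (simp add: a_def b_def)
  have der: "((\<lambda>s. f (y + s *\<^sub>R a)) has_real_derivative iter_partial [i] f (y + s *\<^sub>R a)) (at s)"
    if "y + s *\<^sub>R a \<in> S" for y s
    using smooth_has_derivative_along[OF f that, of "[]" i]
    by - (rule has_derivative_along_shift, simp add: iter_partial_Nil a_def)
  have der2: "((\<lambda>t. iter_partial [i] f (y + t *\<^sub>R b)) has_real_derivative
      iter_partial [j, i] f (y + t *\<^sub>R b)) (at t)" if "y + t *\<^sub>R b \<in> S" for y t
    using smooth_has_derivative_along[OF f that, of "[i]" j]
    by - (rule has_derivative_along_shift, simp add: b_def)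
  define u where "u s = f (x + h *\<^sub>R b + s *\<^sub>R a) - f (x + s *\<^sub>R a)" for s
  have "\<exists>s>0. s < h \<and> u h - u 0 = (h - 0) *
      (iter_partial [i] f (x + h *\<^sub>R b + s *\<^sub>R a) - iter_partial [i] f (x + s *\<^sub>R a))"
  proof (rule MVT2[OF h])
    fix s assume "0 \<le> s" "s \<le> h"
    then show "(u has_real_derivative
        iter_partial [i] f (x + h *\<^sub>R b + s *\<^sub>R a) - iter_partial [i] f (x + s *\<^sub>R a)) (at s)"
      unfolding u_def using box'[of s h] box'[of s 0] h
      by (intro DERIV_diff der) (auto simp: algebra_simps)
  qed
  then obtain s where s: "0 < s" "s < h" and us: "u h - u 0 = h *
      (iter_partial [i] f (x + h *\<^sub>R b + s *\<^sub>R a) - iter_partial [i] f (x + s *\<^sub>R a))"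
    by auto
  have "\<exists>t>0. t < h \<and> iter_partial [i] f (x + s *\<^sub>R a + h *\<^sub>R b) - iter_partial [i] f (x + s *\<^sub>R a + 0 *\<^sub>R b)
      = (h - 0) * iter_partial [j, i] f (x + s *\<^sub>R a + t *\<^sub>R b)"
    using s box' by (intro MVT2[OF h] der2) auto
  then obtain t where t: "0 < t" "t < h" and
    "iter_partial [i] f (x + s *\<^sub>R a + h *\<^sub>R b) - iter_partial [i] f (x + s *\<^sub>R a)
      = h * iter_partial [j, i] f (x + s *\<^sub>R a + t *\<^sub>R b)" by auto
  with us have "u h - u 0 = h\<^sup>2 * iter_partial [j, i] f (x + s *\<^sub>R a + t *\<^sub>R b)"
    by (simp add: power2_eq_square algebra_simps)
  with s t show ?thesis
    unfolding u_def a_def b_def by (intro exI[of _ s] exI[of _ t]) (auto simp: algebra_simps)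
qed

text \<open>The second difference is symmetric in \<open>i\<close> and \<open>j\<close>. Divided by
  \<open>h^2\<close>, it tends by \<open>second_difference\<close> and continuity to each of the two
  mixed derivatives, and limits are unique.\<close>

lemma mixed_partials_commute:
  fixes f :: "real^'n::finite \<Rightarrow> real"
  assumes S: "open S" and x: "x \<in> S" and f: "smooth_on_open S f"
  shows "iter_partial [i, j] f x = iter_partial [j, i] f x"
proof -
  define \<Delta> where "\<Delta> i j h = f (x + h *\<^sub>R axis i 1 + h *\<^sub>R axis j 1) - f (x + h *\<^sub>R axis i 1)
      - f (x + h *\<^sub>R axis j 1) + f x" for i j h
  have lim: "((\<lambda>h. \<Delta> i j h / h\<^sup>2) \<longlongrightarrow> iter_partial [j, i] f x) (at_right 0)" for i j
  proof (rule tendstoI)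
    fix e :: real assume e: "0 < e"
    have "continuous_on S (iter_partial [j, i] f)"
      using f by (simp add: smooth_on_open_def)
    then have "(iter_partial [j, i] f \<longlongrightarrow> iter_partial [j, i] f x) (nhds x)"
      using S x by (simp add: continuous_on_eq_continuous_at isCont_def tendsto_at_iff_tendsto_nhds)
    then have "\<forall>\<^sub>F y in nhds x. dist (iter_partial [j, i] f y) (iter_partial [j, i] f x) < e \<and> y \<in> S"
      using eventually_nhds_in_open[OF S x] by (intro eventually_conj tendstoD[OF _ e])
    then obtain d where d: "0 < d" and
      near: "\<And>y. dist y x < d \<Longrightarrow> dist (iter_partial [j, i] f y) (iter_partial [j, i] f x) < e \<and> y \<in> S"
      unfolding eventually_nhds_metric by blast
    have box: "dist (x + s *\<^sub>R axis i 1 + t *\<^sub>R axis j 1) x < d"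
      if "\<bar>s\<bar> \<le> h" "\<bar>t\<bar> \<le> h" "h < d / 2" for s t h
    proof -
      have "norm (s *\<^sub>R axis i (1::real) + t *\<^sub>R axis j 1) \<le> \<bar>s\<bar> + \<bar>t\<bar>"
        by (rule order_trans[OF norm_triangle_ineq]) (simp add: norm_axis_1)
      then show ?thesis using that by (simp add: dist_norm add.assoc)
    qed
    have "dist (\<Delta> i j h / h\<^sup>2) (iter_partial [j, i] f x) < e" if h: "0 < h" "h < d / 2" for h
    proof -
      have "x + s *\<^sub>R axis i 1 + t *\<^sub>R axis j 1 \<in> S" if "\<bar>s\<bar> \<le> h" "\<bar>t\<bar> \<le> h" for s t
        using near box[OF that h(2)] by blast
      from second_difference[OF h(1) this f] obtain s t where
        st: "0 < s" "s < h" "0 < t" "t < h"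
        and eq: "\<Delta> i j h = h\<^sup>2 * iter_partial [j, i] f (x + s *\<^sub>R axis i 1 + t *\<^sub>R axis j 1)"
        unfolding \<Delta>_def by blast
      have "\<Delta> i j h / h\<^sup>2 = iter_partial [j, i] f (x + s *\<^sub>R axis i 1 + t *\<^sub>R axis j 1)"
        using h eq by simp
      then show ?thesis using near box[of s h t] st h by simp
    qed
    then show "\<forall>\<^sub>F h in at_right 0. dist (\<Delta> i j h / h\<^sup>2) (iter_partial [j, i] f x) < e"
      unfolding eventually_at_right_field using d by (intro exI[of _ "d / 2"]) auto
  qed
  have "\<Delta> i j = \<Delta> j i" by (auto simp: \<Delta>_def fun_eq_iff algebra_simps)
  then have "((\<lambda>h. \<Delta> i j h / h\<^sup>2) \<longlongrightarrow> iter_partial [i, j] f x) (at_right 0)"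
    using lim[of j i] by simp
  from tendsto_unique[OF trivial_limit_at_right_real this lim] show ?thesis .
qed

text \<open>Adjacent swaps, justified by \<open>mixed_partials_commute\<close> for an inner iterated
  derivative, bring the head of \<open>is\<close> to the front of \<open>js\<close>; induction
  handles the tails.\<close>

lemma iter_partial_mset_eq:
  fixes f :: "real^'n::finite \<Rightarrow> real"
  assumes S: "open S" and f: "smooth_on_open S f"
  shows "mset is = mset js \<Longrightarrow> x \<in> S \<Longrightarrow> iter_partial is f x = iter_partial js f x"
proof (induction "is" arbitrary: js x)
  case (Cons i "is")
  have front: "iter_partial (us @ i # vs) f y = iter_partial (i # us @ vs) f y" if "y \<in> S" for us vs y
    using that
  proof (induction us arbitrary: y)
    case (Cons u us)
    have "iter_partial ((u # us) @ i # vs) f y = partial_deriv u (iter_partial (us @ i # vs) f) y"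
      by (simp add: iter_partial_Cons)
    also have "\<dots> = partial_deriv u (iter_partial (i # us @ vs) f) y"
      by (rule partial_deriv_cong[OF S Cons.prems Cons.IH])
    also have "\<dots> = iter_partial [u, i] (iter_partial (us @ vs) f) y"
      by (simp add: iter_partial_Cons iter_partial_Nil)
    also have "\<dots> = iter_partial [i, u] (iter_partial (us @ vs) f) y"
      by (rule mixed_partials_commute[OF S Cons.prems smooth_iter_partial[OF f]])
    finally show ?case by (simp add: iter_partial_Cons iter_partial_Nil)
  qed simp
  have "i \<in> set js" using Cons.prems(1) by (metis list.set_intros(1) set_mset_mset)
  then obtain us vs where js: "js = us @ i # vs" by (meson split_list)
  have "iter_partial (i # is) f x = iter_partial (i # us @ vs) f x"
    unfolding iter_partial_Cons
    using Cons.prems(1) by (intro partial_deriv_cong[OF S Cons.prems(2)] Cons.IH) (simp_all add: js)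
  then show ?case using front[OF Cons.prems(2)] js by simp
qed simp

section \<open>Complete monotonicity\<close>

text \<open>Along a list of indices, every iterated derivative stays, up to sign, equal on the
  orthant to a member of \<open>C\<close>, so all requirements are checked once on members of
  \<open>C\<close>. This avoids closed formulas for higher derivatives of products and
  integrals.\<close>

lemma completely_monotone_coinduct:
  fixes f :: "real^'n::finite \<Rightarrow> real"
  assumes "f \<in> C"
    and cont: "\<And>f. f \<in> C \<Longrightarrow> continuous_on pos_orthant f"
    and nonneg: "\<And>f x. f \<in> C \<Longrightarrow> x \<in> pos_orthant \<Longrightarrow> 0 \<le> f x"
    and deriv: "\<And>f i. f \<in> C \<Longrightarrow> \<exists>g\<in>C. \<forall>x\<in>pos_orthant.
          ((\<lambda>t. f (x + t *\<^sub>R axis i 1)) has_real_derivative - g x) (at 0)"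
  shows "completely_monotone f"
proof -
  have rep: "\<exists>g\<in>C. \<forall>x\<in>pos_orthant. iter_partial is f x = (- 1) ^ length is * g x" for "is"
  proof (induction "is")
    case Nil
    show ?case using assms(1) by (intro bexI[of _ f]) (simp_all add: iter_partial_Nil)
  next
    case (Cons i "is")
    then obtain g where g: "g \<in> C"
      "\<And>x. x \<in> pos_orthant \<Longrightarrow> iter_partial is f x = (- 1) ^ length is * g x"
      by blast
    obtain g' where g': "g' \<in> C" "\<forall>x\<in>pos_orthant.
        ((\<lambda>t. g (x + t *\<^sub>R axis i 1)) has_real_derivative - g' x) (at 0)"
      using deriv[OF g(1)] by blast
    have "iter_partial (i # is) f x = (- 1) ^ length (i # is) * g' x" if "x \<in> pos_orthant" for x
    proof -
      have "((\<lambda>t. (- 1) ^ length is * g (x + t *\<^sub>R axis i 1)) has_real_derivative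
          (- 1) ^ length is * - g' x) (at 0)"
        using g'(2) that by (intro DERIV_cmult) auto
      then have "((\<lambda>t. iter_partial is f (x + t *\<^sub>R axis i 1)) has_real_derivative
          (- 1) ^ length is * - g' x) (at 0)"
        by - (rule has_derivative_along_cong[OF open_pos_orthant that,
            where g = "\<lambda>y. (- 1) ^ length is * g y"], rule g(2))
      from partial_deriv_eqI[OF this] show ?thesis by (simp add: iter_partial_Cons)
    qed
    with g'(1) show ?case by blast
  qed
  show ?thesis
    unfolding completely_monotone_def smooth_on_open_def
  proof (intro conjI allI ballI)
    fix "is" :: "'n list"
    obtain g where g: "g \<in> C" "\<And>x. x \<in> pos_orthant \<Longrightarrow> iter_partial is f x = (- 1) ^ length is * g x"
      using rep by blast
    show "continuous_on pos_orthant (iter_partial is f)"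
      using g cont[OF g(1)] by (simp add: continuous_on_mult_left cong: continuous_on_cong)
    fix x :: "real^'n" assume x: "x \<in> pos_orthant"
    show "0 \<le> (- 1) ^ length is * iter_partial is f x"
      using nonneg[OF g(1) x] g(2)[OF x] by (simp flip: mult.assoc power_mult_distrib)
    fix i
    obtain g' where "((\<lambda>t. g (x + t *\<^sub>R axis i 1)) has_real_derivative - g' x) (at 0)"
      using deriv[OF g(1)] x by blast
    then have "((\<lambda>t. (- 1) ^ length is * g (x + t *\<^sub>R axis i 1)) has_real_derivative
          (- 1) ^ length is * - g' x) (at 0)"
      by (rule DERIV_cmult)
    then have "((\<lambda>t. iter_partial is f (x + t *\<^sub>R axis i 1)) has_real_derivative
          (- 1) ^ length is * - g' x) (at 0)"
      by - (rule has_derivative_along_cong[OF open_pos_orthant x,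
            where g = "\<lambda>y. (- 1) ^ length is * g y"], rule g(2))
    then show "(\<lambda>t. iter_partial is f (x + t *\<^sub>R axis i 1)) differentiable (at 0)"
      unfolding real_differentiable_def by (rule exI)
  qed
qed

text \<open>The class for the coinduction consists of the signed iterated derivatives of
  \<open>f\<close> itself; the function in question is the one for the list
  \<open>[i]\<close>.\<close>

lemma completely_monotone_neg_partial:
  assumes "completely_monotone f"
  shows "completely_monotone (\<lambda>x. - partial_deriv i f x)"
proof (rule completely_monotone_coinduct
    [where C = "range (\<lambda>is x. (- 1) ^ length is * iter_partial is f x)"])
  let ?g = "\<lambda>is x. (- 1) ^ length is * iter_partial is f x"
  have smooth: "smooth_on_open pos_orthant f"
    using assms by (simp add: completely_monotone_def)
  show "(\<lambda>x. - partial_deriv i f x) \<in> range ?g"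
    by (rule range_eqI[of _ _ "[i]"]) (simp add: iter_partial_Cons iter_partial_Nil)
  fix h assume "h \<in> range ?g"
  then obtain "is" where h: "h = ?g is" by blast
  show "continuous_on pos_orthant h"
    using smooth unfolding h smooth_on_open_def by (intro continuous_on_mult_left) blast
  show "0 \<le> h x" if "x \<in> pos_orthant" for x
    using assms that unfolding h completely_monotone_def by blast
  fix j
  have "((\<lambda>t. h (x + t *\<^sub>R axis j 1)) has_real_derivative - ?g (j # is) x) (at 0)"
    if "x \<in> pos_orthant" for x
    unfolding h using DERIV_cmult[OF smooth_has_derivative_along[OF smooth that]] by simp
  then show "\<exists>g\<in>range ?g. \<forall>x\<in>pos_orthant.
      ((\<lambda>t. h (x + t *\<^sub>R axis j 1)) has_real_derivative - g x) (at 0)"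
    by (intro bexI[of _ "?g (j # is)"] ballI rangeI)
qed

lemma completely_monotoneD:
  assumes "completely_monotone f"
  shows "continuous_on pos_orthant f"
    and "x \<in> pos_orthant \<Longrightarrow> 0 \<le> f x"
    and "x \<in> pos_orthant \<Longrightarrow>
      ((\<lambda>t. f (x + t *\<^sub>R axis i 1)) has_real_derivative partial_deriv i f x) (at 0)"
proof -
  have smooth: "smooth_on_open pos_orthant f"
    using assms by (simp add: completely_monotone_def)
  then show "continuous_on pos_orthant f"
    unfolding smooth_on_open_def by (metis iter_partial_Nil)
  show "x \<in> pos_orthant \<Longrightarrow> 0 \<le> f x"
    using assms unfolding completely_monotone_def
    by (metis iter_partial_Nil list.size(3) mult_1 power_0)
  show "x \<in> pos_orthant \<Longrightarrow>
      ((\<lambda>t. f (x + t *\<^sub>R axis i 1)) has_real_derivative partial_deriv i f x) (at 0)"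
    using smooth_has_derivative_along[OF smooth, of x "[]" i]
    by (simp add: iter_partial_Cons iter_partial_Nil)
qed

section \<open>Products of completely monotone functions\<close>

text \<open>The Leibniz rule turns one product into a sum of two, so products alone are not a
  suitable class for the coinduction, whereas finite sums of products are.\<close>

inductive_set cm_product_sums :: "(real^'n::finite \<Rightarrow> real) set" where
  mult: "completely_monotone u \<Longrightarrow> completely_monotone v \<Longrightarrow> (\<lambda>x. u x * v x) \<in> cm_product_sums"
| add: "f \<in> cm_product_sums \<Longrightarrow> g \<in> cm_product_sums \<Longrightarrow> (\<lambda>x. f x + g x) \<in> cm_product_sums"

lemma completely_monotone_mult:
  assumes "completely_monotone u" "completely_monotone v"
  shows "completely_monotone (\<lambda>x. u x * v x)"
proof (rule completely_monotone_coinduct[where C = cm_product_sums])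
  show "(\<lambda>x. u x * v x) \<in> cm_product_sums"
    using assms by (rule cm_product_sums.mult)
  fix f :: "real^'n \<Rightarrow> real" assume f: "f \<in> cm_product_sums"
  show "continuous_on pos_orthant f"
    using f by induction (simp_all add: continuous_on_mult continuous_on_add completely_monotoneD(1))
  show "0 \<le> f x" if "x \<in> pos_orthant" for x
    using f that by induction (simp_all add: completely_monotoneD(2))
  fix i
  show "\<exists>g\<in>cm_product_sums. \<forall>x\<in>pos_orthant.
      ((\<lambda>t. f (x + t *\<^sub>R axis i 1)) has_real_derivative - g x) (at 0)"
    using f
  proof induction
    case (mult u v)
    have "((\<lambda>t. u (x + t *\<^sub>R axis i 1) * v (x + t *\<^sub>R axis i 1)) has_real_derivative
        - ((- partial_deriv i u x) * v x + u x * (- partial_deriv i v x))) (at 0)"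
      if "x \<in> pos_orthant" for x
      using DERIV_mult[OF completely_monotoneD(3)[OF mult(1) that, of i]
          completely_monotoneD(3)[OF mult(2) that, of i]]
      by (simp add: algebra_simps)
    then show ?case
      by (intro bexI[OF _ cm_product_sums.add[OF
            cm_product_sums.mult[OF completely_monotone_neg_partial[OF mult(1)] mult(2)]
            cm_product_sums.mult[OF mult(1) completely_monotone_neg_partial[OF mult(2)]]]] ballI)
  next
    case (add f g)
    then obtain f' g' where "f' \<in> cm_product_sums" "g' \<in> cm_product_sums" and
      d: "\<forall>x\<in>pos_orthant. ((\<lambda>t. f (x + t *\<^sub>R axis i 1)) has_real_derivative - f' x) (at 0)"
         "\<forall>x\<in>pos_orthant. ((\<lambda>t. g (x + t *\<^sub>R axis i 1)) has_real_derivative - g' x) (at 0)"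
      by blast
    moreover have "((\<lambda>t. f (x + t *\<^sub>R axis i 1) + g (x + t *\<^sub>R axis i 1)) has_real_derivative
        - (f' x + g' x)) (at 0)" if "x \<in> pos_orthant" for x
      using DERIV_add[OF d(1)[rule_format, OF that] d(2)[rule_format, OF that]] by simp
    ultimately show ?case
      by (intro bexI[of _ "\<lambda>x. f' x + g' x"] ballI cm_product_sums.add)
  qed
qed

section \<open>Mixtures of negative powers of linear forms\<close>

text \<open>By the mean value inequality, \<open>w\<close> dominates the difference quotients as
  well, so dominated convergence applies along every sequence tending to 0.\<close>

lemma has_real_derivative_integral:
  fixes \<phi> :: "real \<Rightarrow> 'a \<Rightarrow> real"
  assumes \<delta>: "0 < \<delta>"
    and int: "\<And>t. \<bar>t\<bar> < \<delta> \<Longrightarrow> integrable M (\<phi> t)"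
    and der: "\<And>t \<omega>. \<bar>t\<bar> < \<delta> \<Longrightarrow> ((\<lambda>t. \<phi> t \<omega>) has_real_derivative \<phi>' t \<omega>) (at t)"
    and bound: "\<And>t \<omega>. \<bar>t\<bar> < \<delta> \<Longrightarrow> \<bar>\<phi>' t \<omega>\<bar> \<le> w \<omega>"
    and w: "integrable M w" and meas: "\<phi>' 0 \<in> borel_measurable M"
  shows "((\<lambda>t. \<integral>\<omega>. \<phi> t \<omega> \<partial>M) has_real_derivative (\<integral>\<omega>. \<phi>' 0 \<omega> \<partial>M)) (at 0)"
proof -
  define U where "U = {- \<delta><..<\<delta>}"
  have at0: "at 0 within U = at (0::real)"
    unfolding U_def using \<delta> by (intro at_within_open) auto
  have "((\<lambda>h. ((\<integral>\<omega>. \<phi> h \<omega> \<partial>M) - (\<integral>\<omega>. \<phi> 0 \<omega> \<partial>M)) / h) \<longlongrightarrow> (\<integral>\<omega>. \<phi>' 0 \<omega> \<partial>M)) (at 0 within U)"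
    unfolding tendsto_at_iff_sequentially
  proof (intro allI impI)
    fix X assume X: "\<forall>n. X n \<in> U - {0}" "X \<longlonglongrightarrow> 0"
    have Xn: "\<bar>X n\<bar> < \<delta>" "X n \<noteq> 0" for n
      using X(1)[rule_format, of n] by (auto simp: U_def)
    have "(\<lambda>n. \<integral>\<omega>. (\<phi> (X n) \<omega> - \<phi> 0 \<omega>) / X n \<partial>M) \<longlonglongrightarrow> (\<integral>\<omega>. \<phi>' 0 \<omega> \<partial>M)"
    proof (rule integral_dominated_convergence[where w = w, OF meas _ w])
      show "(\<lambda>\<omega>. (\<phi> (X n) \<omega> - \<phi> 0 \<omega>) / X n) \<in> borel_measurable M" for n
        using int[of "X n"] int[of 0] Xn \<delta> by simp
      have "(\<lambda>n. (\<phi> (X n) \<omega> - \<phi> 0 \<omega>) / X n) \<longlonglongrightarrow> \<phi>' 0 \<omega>" for \<omega>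
      proof -
        have "((\<lambda>h. (\<phi> h \<omega> - \<phi> 0 \<omega>) / h) \<longlongrightarrow> \<phi>' 0 \<omega>) (at 0)"
          using der[of 0 \<omega>] \<delta> by (simp add: has_field_derivative_iff)
        moreover have "filterlim X (at 0) sequentially"
          using X Xn by (simp add: filterlim_at)
        ultimately show ?thesis by (rule filterlim_compose)
      qed
      then show "AE \<omega> in M. (\<lambda>n. (\<phi> (X n) \<omega> - \<phi> 0 \<omega>) / X n) \<longlonglongrightarrow> \<phi>' 0 \<omega>"
        by simp
      have "norm ((\<phi> (X n) \<omega> - \<phi> 0 \<omega>) / X n) \<le> w \<omega>" for n \<omega>
      proof -
        have "norm (\<phi> (X n) \<omega> - \<phi> 0 \<omega>) \<le> w \<omega> * norm (X n - 0)"
        proof (rule field_differentiable_bound)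
          show "convex U" by (simp add: U_def)
          show "0 \<in> U" "X n \<in> U" using X \<delta> by (auto simp: U_def)
          fix t assume "t \<in> U"
          then have t: "\<bar>t\<bar> < \<delta>" by (auto simp: U_def)
          show "((\<lambda>t. \<phi> t \<omega>) has_field_derivative \<phi>' t \<omega>) (at t within U)"
            using der[OF t] by (rule has_field_derivative_at_within)
          show "norm (\<phi>' t \<omega>) \<le> w \<omega>" using bound[OF t] by simp
        qed
        then show ?thesis using Xn[of n] by (simp add: divide_le_eq)
      qed
      then show "AE \<omega> in M. norm ((\<phi> (X n) \<omega> - \<phi> 0 \<omega>) / X n) \<le> w \<omega>" for n
        by simp
    qed
    moreover have "(\<integral>\<omega>. (\<phi> (X n) \<omega> - \<phi> 0 \<omega>) / X n \<partial>M)
        = ((\<integral>\<omega>. \<phi> (X n) \<omega> \<partial>M) - (\<integral>\<omega>. \<phi> 0 \<omega> \<partial>M)) / X n" for n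
      using int[of "X n"] int[of 0] Xn \<delta> by simp
    ultimately show "((\<lambda>h. ((\<integral>\<omega>. \<phi> h \<omega> \<partial>M) - (\<integral>\<omega>. \<phi> 0 \<omega> \<partial>M)) / h) \<circ> X) \<longlonglongrightarrow> (\<integral>\<omega>. \<phi>' 0 \<omega> \<partial>M)"
      unfolding o_def by (simp only:)
  qed
  then show ?thesis
    by (simp add: at0 has_field_derivative_iff)
qed

lemma powr_neg_antimono: "0 < a \<Longrightarrow> a \<le> b \<Longrightarrow> 0 \<le> g \<Longrightarrow> b powr - g \<le> a powr - (g::real)"
  by (rule powr_mono2') auto

lemma inner_pos_orthant:
  assumes "x \<in> pos_orthant" "\<And>i. 0 \<le> c $ i"
  shows "0 \<le> c \<bullet> x" and "c \<noteq> 0 \<Longrightarrow> 0 < c \<bullet> (x :: real^'n::finite)" and "c $ i * x $ i \<le> c \<bullet> x"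
proof -
  have nn: "0 \<le> c $ i * x $ i" for i
    using assms(2)[of i] pos_orthantD[OF assms(1), of i] by simp
  then show "0 \<le> c \<bullet> x" by (simp add: inner_vec_def sum_nonneg)
  show le: "c $ i * x $ i \<le> c \<bullet> x" for i
    unfolding inner_vec_def inner_real_def by (rule member_le_sum) (use nn in auto)
  assume "c \<noteq> 0"
  then obtain j where "c $ j \<noteq> 0" by (auto simp: vec_eq_iff)
  then have "0 < c $ j * x $ j"
    using assms(2)[of j] pos_orthantD[OF assms(1), of j] by simp
  with le[of j] show "0 < c \<bullet> x" by simp
qed

lemma inner_pos_orthant_mono:
  fixes x y :: "real^'n::finite"
  assumes "\<And>i. 0 \<le> c $ i" "\<And>i. x $ i \<le> y $ i"
  shows "c \<bullet> x \<le> c \<bullet> y"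
  unfolding inner_vec_def inner_real_def by (intro sum_mono mult_left_mono assms)

locale neg_power_mixture =
  fixes M :: "'a measure" and c :: "'a \<Rightarrow> real^'n::finite"
  assumes c_meas [measurable]: "c \<in> borel_measurable M"
    and c_nonneg: "\<And>\<omega> i. 0 \<le> c \<omega> $ i"
begin

lemma c_nth_meas [measurable]: "(\<lambda>\<omega>. c \<omega> $ i) \<in> borel_measurable M"
  using borel_measurable_inner[OF c_meas borel_measurable_const[of "axis i 1"]]
  by (simp add: inner_axis)

definition kernel :: "('a \<Rightarrow> real) \<Rightarrow> real \<Rightarrow> real^'n \<Rightarrow> 'a \<Rightarrow> real" where
  "kernel p g x \<omega> = p \<omega> * (c \<omega> \<bullet> x) powr - g"

text \<open>Weight and exponent vary together because a derivative in \<open>x_i\<close> replaces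
  \<open>p\<close> by \<open>g * p * c_i\<close> and \<open>g\<close> by \<open>g + 1\<close>. These
  pairs index the class for the coinduction below.\<close>

definition admissible :: "('a \<Rightarrow> real) \<Rightarrow> real \<Rightarrow> bool" where
  "admissible p g \<longleftrightarrow> 0 \<le> g \<and> p \<in> borel_measurable M \<and> (\<forall>\<omega>. 0 \<le> p \<omega>) \<and>
     (\<forall>x\<in>pos_orthant. integrable M (kernel p g x))"

lemma kernel_mono:
  assumes "0 \<le> p \<omega>" "0 \<le> g" "x \<in> pos_orthant" "\<And>i. x $ i \<le> y $ i"
  shows "kernel p g y \<omega> \<le> kernel p g x \<omega>"
\<comment> \<open>Since \<open>0 powr a = 0\<close>, the kernel vanishes where
  \<open>c \<omega> = 0\<close>; elsewhere \<open>c \<omega> \<bullet> x\<close> is positive on the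
  orthant.\<close>
proof (cases "c \<omega> = 0")
  case False
  then show ?thesis unfolding kernel_def
    using assms inner_pos_orthant(2)[OF assms(3) c_nonneg]
    by (intro mult_left_mono powr_neg_antimono inner_pos_orthant_mono[OF c_nonneg]) auto
qed (simp add: kernel_def)

lemma kernel_deriv:
  assumes "x + t *\<^sub>R axis i 1 \<in> pos_orthant"
  shows "((\<lambda>t. kernel p g (x + t *\<^sub>R axis i 1) \<omega>) has_real_derivative
     - kernel (\<lambda>\<omega>. g * (p \<omega> * c \<omega> $ i)) (g + 1) (x + t *\<^sub>R axis i 1) \<omega>) (at t)"
proof (cases "c \<omega> = 0")
  case False
  have pos: "0 < c \<omega> \<bullet> x + t * c \<omega> $ i"
    using inner_pos_orthant(2)[OF assms c_nonneg False] by (simp add: inner_add_right inner_axis)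
  have "((\<lambda>t. c \<omega> \<bullet> x + t * c \<omega> $ i) has_real_derivative c \<omega> $ i) (at t)"
    by (auto intro!: derivative_eq_intros)
  from DERIV_cmult[OF DERIV_fun_powr[OF this pos, of "- g"], of "p \<omega>"] show ?thesis
    by (simp add: kernel_def inner_add_right inner_axis mult_ac)
qed (simp add: kernel_def)

text \<open>From \<open>c_i * x_i \<le> c \<bullet> x\<close>, the new factor
  \<open>c_i / (c \<bullet> x)\<close> is at most \<open>1 / x_i\<close>, so the new kernel is
  dominated by \<open>g / x_i\<close> times the old one.\<close>

lemma admissible_deriv:
  assumes "admissible p g"
  shows "admissible (\<lambda>\<omega>. g * (p \<omega> * c \<omega> $ i)) (g + 1)"
  unfolding admissible_def
proof (intro conjI ballI allI)
  from assms have g: "0 \<le> g" and p [measurable]: "p \<in> borel_measurable M" and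
    p0: "\<And>\<omega>. 0 \<le> p \<omega>" and int: "\<And>x. x \<in> pos_orthant \<Longrightarrow> integrable M (kernel p g x)"
    by (auto simp: admissible_def)
  show "0 \<le> g + 1" using g by simp
  show "0 \<le> g * (p \<omega> * c \<omega> $ i)" for \<omega> using g p0 c_nonneg by simp
  show [measurable]: "(\<lambda>\<omega>. g * (p \<omega> * c \<omega> $ i)) \<in> borel_measurable M" by measurable
  fix x :: "real^'n" assume x: "x \<in> pos_orthant"
  have xi: "0 < x $ i" using x by (rule pos_orthantD)
  have "kernel (\<lambda>\<omega>. g * (p \<omega> * c \<omega> $ i)) (g + 1) x \<omega> \<le> g / x $ i * kernel p g x \<omega>" for \<omega>
  proof (cases "c \<omega> = 0")
    case False
    let ?l = "c \<omega> \<bullet> x"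
    have l: "0 < ?l" by (rule inner_pos_orthant(2)[OF x c_nonneg False])
    have "c \<omega> $ i * ?l powr - (g + 1) = c \<omega> $ i / ?l * ?l powr - g"
      using l by (simp add: powr_diff flip: powr_minus_divide)
    also have "\<dots> \<le> 1 / x $ i * ?l powr - g"
      using inner_pos_orthant(3)[OF x c_nonneg, of \<omega> i] l xi
      by (intro mult_right_mono) (simp_all add: field_simps)
    finally have "g * p \<omega> * (c \<omega> $ i * ?l powr - (g + 1)) \<le> g * p \<omega> * (1 / x $ i * ?l powr - g)"
      using g p0 by (intro mult_left_mono) auto
    then show ?thesis by (simp add: kernel_def mult_ac)
  qed (simp add: kernel_def)
  moreover have "0 \<le> kernel (\<lambda>\<omega>. g * (p \<omega> * c \<omega> $ i)) (g + 1) x \<omega>" for \<omega>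
    using g p0 c_nonneg by (simp add: kernel_def)
  ultimately have bound: "norm (kernel (\<lambda>\<omega>. g * (p \<omega> * c \<omega> $ i)) (g + 1) x \<omega>)
      \<le> norm (g / x $ i * kernel p g x \<omega>)" for \<omega>
    unfolding real_norm_def by (smt (verit))
  have meas: "kernel (\<lambda>\<omega>. g * (p \<omega> * c \<omega> $ i)) (g + 1) x \<in> borel_measurable M"
    unfolding kernel_def by measurable
  have "integrable M (\<lambda>\<omega>. g / x $ i * kernel p g x \<omega>)"
    using int[OF x] by (rule integrable_mult_right)
  from Bochner_Integration.integrable_bound[OF this meas AE_I2[OF bound]]
  show "integrable M (kernel (\<lambda>\<omega>. g * (p \<omega> * c \<omega> $ i)) (g + 1) x)" .
qed

lemma completely_monotone_mixture:
  assumes "admissible p g"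
  shows "completely_monotone (\<lambda>x. \<integral>\<omega>. p \<omega> * (c \<omega> \<bullet> x) powr - g \<partial>M)"
proof (rule completely_monotone_coinduct
    [where C = "{\<lambda>x. \<integral>\<omega>. kernel p g x \<omega> \<partial>M | p g. admissible p g}"])
  let ?C = "{\<lambda>x. \<integral>\<omega>. kernel p g x \<omega> \<partial>M | p g. admissible p g}"
  show "(\<lambda>x. \<integral>\<omega>. p \<omega> * (c \<omega> \<bullet> x) powr - g \<partial>M) \<in> ?C"
    using assms unfolding kernel_def by blast
  fix f assume "f \<in> ?C"
  then obtain p g where f: "f = (\<lambda>x. \<integral>\<omega>. kernel p g x \<omega> \<partial>M)" and adm: "admissible p g" by blast
  from adm have g: "0 \<le> g" and p [measurable]: "p \<in> borel_measurable M" and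
    p0: "\<And>\<omega>. 0 \<le> p \<omega>" and int: "\<And>x. x \<in> pos_orthant \<Longrightarrow> integrable M (kernel p g x)"
    by (auto simp: admissible_def)
  have k0: "0 \<le> kernel p g x \<omega>" for x \<omega> by (simp add: kernel_def p0)
  show "0 \<le> f x" for x by (simp add: f k0)
  show "continuous_on pos_orthant f"
    unfolding continuous_on_eq_continuous_at[OF open_pos_orthant] continuous_at_sequentially
  proof (intro ballI allI impI)
    fix x :: "real^'n" and X assume x: "x \<in> pos_orthant" and X: "X \<longlonglongrightarrow> x"
    \<comment> \<open>Kernels decrease in each coordinate. As almost all \<open>X n\<close> lie
      above \<open>x / 2\<close>, the kernel at \<open>x / 2\<close> is an integrable bound for
      theirs.\<close>
    define x' where "x' = (1/2) *\<^sub>R x"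
    have x': "x' \<in> pos_orthant" using x by (simp add: x'_def pos_orthant_def)
    have "\<forall>\<^sub>F n in sequentially. \<forall>i. x' $ i < X n $ i"
    proof (rule eventually_all_finite)
      fix i
      have "(\<lambda>n. X n $ i) \<longlonglongrightarrow> x $ i" using X by (rule tendsto_vec_nth)
      moreover have "x' $ i < x $ i" using pos_orthantD[OF x, of i] by (simp add: x'_def)
      ultimately show "\<forall>\<^sub>F n in sequentially. x' $ i < X n $ i"
        by (rule order_tendstoD(1))
    qed
    then obtain N where N: "\<And>n i. N \<le> n \<Longrightarrow> x' $ i < X n $ i"
      unfolding eventually_sequentially by blast
    have pos: "X (n + N) \<in> pos_orthant" for n
      using N[of "n + N"] pos_orthantD[OF x'] by (force simp: pos_orthant_def intro: less_trans)
    have "(\<lambda>n. \<integral>\<omega>. kernel p g (X (n + N)) \<omega> \<partial>M) \<longlonglongrightarrow> (\<integral>\<omega>. kernel p g x \<omega> \<partial>M)"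
    proof (rule integral_dominated_convergence[where w = "kernel p g x'"])
      show "kernel p g x \<in> borel_measurable M" "integrable M (kernel p g x')"
        "kernel p g (X (n + N)) \<in> borel_measurable M" for n
        using int[OF x] int[OF x'] int[OF pos] by auto
      have "(\<lambda>n. kernel p g (X (n + N)) \<omega>) \<longlonglongrightarrow> kernel p g x \<omega>" for \<omega>
      proof (cases "c \<omega> = 0")
        case False
        then have "c \<omega> \<bullet> x \<noteq> 0" using inner_pos_orthant(2)[OF x c_nonneg] by force
        then show ?thesis
          unfolding kernel_def using LIMSEQ_ignore_initial_segment[OF X] by (intro tendsto_intros) auto
      qed (simp add: kernel_def)
      then show "AE \<omega> in M. (\<lambda>n. kernel p g (X (n + N)) \<omega>) \<longlonglongrightarrow> kernel p g x \<omega>" by simp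
      have "kernel p g (X (n + N)) \<omega> \<le> kernel p g x' \<omega>" for n \<omega>
        using N[of "n + N"] by (intro kernel_mono p0 g x') (simp add: less_imp_le)
      then show "AE \<omega> in M. norm (kernel p g (X (n + N)) \<omega>) \<le> kernel p g x' \<omega>" for n
        by (simp add: k0)
    qed
    then show "(f \<circ> X) \<longlonglongrightarrow> f x"
      unfolding f o_def by (rule LIMSEQ_offset)
  qed
  fix i
  let ?p = "\<lambda>\<omega>. g * (p \<omega> * c \<omega> $ i)"
  have adm': "admissible ?p (g + 1)" by (rule admissible_deriv[OF adm])
  have "((\<lambda>t. f (x + t *\<^sub>R axis i 1)) has_real_derivative - (\<integral>\<omega>. kernel ?p (g + 1) x \<omega> \<partial>M)) (at 0)"
    if x: "x \<in> pos_orthant" for x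
  proof -
    \<comment> \<open>This point lies below \<open>x + t *\<^sub>R axis i 1\<close> whenever
      \<open>\<bar>t\<bar> < x $ i / 2\<close>, so the kernel there dominates the derivatives
      uniformly in \<open>t\<close>.\<close>
    define x' where "x' = x - (x $ i / 2) *\<^sub>R axis i 1"
    have xi: "0 < x $ i" using x by (rule pos_orthantD)
    have x': "x' \<in> pos_orthant"
      using x by (auto simp: x'_def pos_orthant_def axis_def)
    have pos: "x + t *\<^sub>R axis i 1 \<in> pos_orthant" and le: "x' $ j \<le> (x + t *\<^sub>R axis i 1) $ j"
      if "\<bar>t\<bar> < x $ i / 2" for t j
      using x that by (auto simp: x'_def pos_orthant_def axis_def abs_if split: if_splits)
    have "((\<lambda>t. \<integral>\<omega>. kernel p g (x + t *\<^sub>R axis i 1) \<omega> \<partial>M) has_real_derivative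
        (\<integral>\<omega>. - kernel ?p (g + 1) (x + 0 *\<^sub>R axis i 1) \<omega> \<partial>M)) (at 0)"
    proof (rule has_real_derivative_integral[where \<delta> = "x $ i / 2" and w = "kernel ?p (g + 1) x'"])
      show "integrable M (kernel ?p (g + 1) x')"
        using adm' x' by (simp add: admissible_def)
      show "(\<lambda>\<omega>. - kernel ?p (g + 1) (x + 0 *\<^sub>R axis i 1) \<omega>) \<in> borel_measurable M"
        unfolding kernel_def by measurable
      fix t assume t: "\<bar>t\<bar> < x $ i / 2"
      show "integrable M (kernel p g (x + t *\<^sub>R axis i 1))" by (rule int[OF pos[OF t]])
      fix \<omega>
      show "((\<lambda>t. kernel p g (x + t *\<^sub>R axis i 1) \<omega>) has_real_derivative
          - kernel ?p (g + 1) (x + t *\<^sub>R axis i 1) \<omega>) (at t)"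
        by (rule kernel_deriv[OF pos[OF t]])
      have "kernel ?p (g + 1) (x + t *\<^sub>R axis i 1) \<omega> \<le> kernel ?p (g + 1) x' \<omega>"
        using g p0 c_nonneg by (intro kernel_mono x' le[OF t]) auto
      then show "\<bar>- kernel ?p (g + 1) (x + t *\<^sub>R axis i 1) \<omega>\<bar> \<le> kernel ?p (g + 1) x' \<omega>"
        using g p0 c_nonneg by (simp add: kernel_def)
    qed (use xi in simp)
    then show ?thesis by (simp add: f)
  qed
  with adm' show "\<exists>h\<in>?C. \<forall>x\<in>pos_orthant.
      ((\<lambda>t. f (x + t *\<^sub>R axis i 1)) has_real_derivative - h x) (at 0)"
    by (intro bexI[of _ "\<lambda>x. \<integral>\<omega>. kernel ?p (g + 1) x \<omega> \<partial>M"] ballI CollectI exI conjI refl) auto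
qed

end

text \<open>A single power is a mixture over a one-point space with constant weight
  \<open>k\<close>.\<close>

lemma completely_monotone_linear_powr:
  fixes c :: "real^'n::finite"
  assumes "\<And>i. 0 \<le> c $ i" "0 \<le> g" "0 \<le> k"
  shows "completely_monotone (\<lambda>x. k * (c \<bullet> x) powr - g)"
proof -
  interpret neg_power_mixture "count_space {()}" "\<lambda>_. c"
    by unfold_locales (use assms in auto)
  have "admissible (\<lambda>_. k) g"
    using assms by (auto simp: admissible_def intro!: integrable_count_space)
  from completely_monotone_mixture[OF this] show ?thesis
    by (simp add: lebesgue_integral_count_space_finite)
qed

section \<open>The integral representation\<close>

text \<open>For \<open>q > 1/2\<close> this is the Beta value \<open>B(1/2, q - 1/2)\<close>; only
  its finiteness and positivity matter. Values in \<open>ennreal\<close> allow iterated integration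
  before integrability is known.\<close>

definition kappa :: "real \<Rightarrow> ennreal" where
  "kappa q = (\<integral>\<^sup>+u. ennreal ((1 + u\<^sup>2) powr - q) \<partial>lborel)"

lemma nn_integral_quadratic_powr:
  fixes s B q m :: real
  assumes s: "0 < s" and B: "0 < B"
  shows "(\<integral>\<^sup>+b. ennreal ((s * (b - m)\<^sup>2 + B) powr - q) \<partial>lborel)
    = ennreal (s powr (- 1/2) * B powr (1/2 - q)) * kappa q"
proof -
  \<comment> \<open>With this \<open>r\<close>, the substitution \<open>b = m + r * u\<close> turns
    the quadratic into \<open>B * (1 + u^2)\<close>.\<close>
  define r where "r = sqrt (B / s)"
  have r: "0 < r" "s * r\<^sup>2 = B" using s B by (simp_all add: r_def)
  have pos: "0 < 1 + u\<^sup>2" for u :: real by (simp add: add_pos_nonneg)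
  have "(s * ((m + r * u) - m)\<^sup>2 + B) powr - q = B powr - q * (1 + u\<^sup>2) powr - q" for u
  proof -
    have "s * ((m + r * u) - m)\<^sup>2 + B = (s * r\<^sup>2) * u\<^sup>2 + B"
      by (simp add: power_mult_distrib)
    also have "\<dots> = B * (1 + u\<^sup>2)" by (simp add: r algebra_simps)
    finally show ?thesis using B pos[of u] by (simp add: powr_mult)
  qed
  then have "(\<integral>\<^sup>+b. ennreal ((s * (b - m)\<^sup>2 + B) powr - q) \<partial>lborel)
      = ennreal r * (\<integral>\<^sup>+u. ennreal (B powr - q * (1 + u\<^sup>2) powr - q) \<partial>lborel)"
    using r by (subst nn_integral_real_affine[where c = r and t = m]) simp_all
  also have "\<dots> = ennreal r * (ennreal (B powr - q) * kappa q)"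
    unfolding kappa_def by (subst nn_integral_cmult[symmetric]) (simp_all add: ennreal_mult')
  also have "\<dots> = ennreal (r * B powr - q) * kappa q"
    using r by (simp add: ennreal_mult' mult.assoc)
  also have "r = s powr (- 1/2) * B powr (1/2)"
    using s B unfolding r_def
    by (simp add: powr_half_sqrt[symmetric] powr_divide powr_minus_divide)
  also have "s powr (- 1/2) * B powr (1/2) * B powr - q = s powr (- 1/2) * B powr (1/2 - q)"
    by (simp flip: powr_add)
  finally show ?thesis .
qed

text \<open>Comparison with \<open>1 / (1 + u^2)\<close>; the exponents that occur later are
  \<open>\<beta> + 1\<close> and \<open>\<beta> + 1/2\<close>.\<close>

lemma kappa_finite:
  assumes "1 \<le> q"
  shows "kappa q < \<infinity>"
proof -
  have "integrable lborel (\<lambda>x. inverse (1 + x\<^sup>2) :: real)"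
    using integrable_inverse_1_plus_square by (simp add: set_integrable_def einterval_def)
  then have "(\<integral>\<^sup>+x. ennreal (inverse (1 + x\<^sup>2)) \<partial>lborel) < \<infinity>"
    by (simp add: integrable_iff_bounded)
  moreover have "kappa q \<le> (\<integral>\<^sup>+x. ennreal (inverse (1 + x\<^sup>2)) \<partial>lborel)"
    unfolding kappa_def
  proof (intro nn_integral_mono ennreal_leI)
    fix x :: real
    have "(1 + x\<^sup>2) powr - q \<le> (1 + x\<^sup>2) powr - 1"
      using assms by (intro powr_mono) auto
    also have "\<dots> = inverse (1 + x\<^sup>2)"
      by (subst powr_neg_one) (auto simp: inverse_eq_divide add_pos_nonneg)
    finally show "(1 + x\<^sup>2) powr - q \<le> inverse (1 + x\<^sup>2)" .
  qed
  ultimately show ?thesis by (rule order.strict_trans1[rotated])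
qed

lemma kappa_pos: "0 < kappa q"
proof -
  have "\<not> (AE u in lborel. ennreal ((1 + u\<^sup>2) powr - q) = 0)"
  proof
    assume "AE u in lborel. ennreal ((1 + u\<^sup>2) powr - q) = 0"
    moreover have "1 + u\<^sup>2 \<noteq> 0" for u :: real
      by (metis add_pos_nonneg less_irrefl zero_le_power2 zero_less_one)
    ultimately have "AE u :: real in lborel. False"
      by (simp add: ennreal_eq_0_iff)
    then show False by (simp add: AE_iff_measurable[where N = UNIV])
  qed
  then have "kappa q \<noteq> 0"
    unfolding kappa_def by (subst nn_integral_0_iff_AE) auto
  then show ?thesis by (simp add: zero_less_iff_neq_zero)
qed

text \<open>The first three coordinates are the squared distances of \<open>(a, b)\<close> from the vertices of an
  equilateral triangle with unit sides.\<close>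

definition tri_form :: "real \<times> real \<Rightarrow> real^4" where
  "tri_form v = ((fst v)\<^sup>2 + (snd v)\<^sup>2) *\<^sub>R axis 1 1 + ((fst v - 1)\<^sup>2 + (snd v)\<^sup>2) *\<^sub>R axis 2 1 +
     ((fst v - 1/2)\<^sup>2 + (snd v - sqrt 3 / 2)\<^sup>2) *\<^sub>R axis 3 1 + axis 4 1"

lemma tri_form_nth:
  "tri_form v $ 1 = (fst v)\<^sup>2 + (snd v)\<^sup>2" "tri_form v $ 2 = (fst v - 1)\<^sup>2 + (snd v)\<^sup>2"
  "tri_form v $ 3 = (fst v - 1/2)\<^sup>2 + (snd v - sqrt 3 / 2)\<^sup>2" "tri_form v $ 4 = 1"
  by (simp_all add: tri_form_def axis_def)

lemma tri_form_nonneg: "0 \<le> tri_form v $ i"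
  using exhaust_4[of i] by (auto simp: tri_form_nth)

lemma tri_form_meas: "tri_form \<in> borel_measurable (lborel \<Otimes>\<^sub>M lborel)"
  unfolding tri_form_def by measurable

lemma E24_pos: "x \<in> pos_orthant \<Longrightarrow> 0 < E24 x"
  by (simp add: E24_def pos_orthant_def add_pos_pos)

text \<open>Completing squares about the centroid of the triangle's vertices with weights
  \<open>x_1, x_2, x_3\<close>: the remainder is the sum of \<open>x_i * x_j / s\<close> times the
  squared side lengths, all 1, plus \<open>x_4\<close>, and this is
  \<open>E24 x / s\<close>.\<close>

lemma tri_form_inner:
  fixes x :: "real^4"
  defines "s \<equiv> x $ 1 + x $ 2 + x $ 3"
  assumes x: "x \<in> pos_orthant"
  shows "tri_form (a, b) \<bullet> x = s * (b - sqrt 3 * x $ 3 / (2 * s))\<^sup>2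
    + (s * (a - (x $ 2 + x $ 3 / 2) / s)\<^sup>2 + E24 x / s)"
proof -
  have s: "0 < s" using x by (simp add: s_def pos_orthant_def add_pos_pos)
  have sq: "s * (c - d / s)\<^sup>2 = s * c\<^sup>2 - 2 * c * d + d\<^sup>2 / s" for c d
    using s by (simp add: power2_eq_square field_simps)
  have 1: "s * (b - sqrt 3 * x $ 3 / (2 * s))\<^sup>2 = s * b\<^sup>2 - b * (sqrt 3 * x $ 3) + (3/4 * (x $ 3)\<^sup>2) / s"
    using sq[of b "sqrt 3 * x $ 3 / 2"] by (simp add: power_mult_distrib power_divide)
  have 2: "s * (a - (x $ 2 + x $ 3 / 2) / s)\<^sup>2
      = s * a\<^sup>2 - 2 * a * (x $ 2 + x $ 3 / 2) + (x $ 2 + x $ 3 / 2)\<^sup>2 / s"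
    by (rule sq)
  have "3/4 * (x $ 3)\<^sup>2 + (x $ 2 + x $ 3 / 2)\<^sup>2 + E24 x = s * (x $ 2 + x $ 3 + x $ 4)"
    by (simp add: s_def E24_def power2_eq_square algebra_simps)
  then have 3: "(3/4 * (x $ 3)\<^sup>2) / s + (x $ 2 + x $ 3 / 2)\<^sup>2 / s + E24 x / s = x $ 2 + x $ 3 + x $ 4"
    using s by (simp add: field_simps)
  have "tri_form (a, b) \<bullet> x = s * b\<^sup>2 - b * (sqrt 3 * x $ 3)
      + (s * a\<^sup>2 - 2 * a * (x $ 2 + x $ 3 / 2)) + (x $ 2 + x $ 3 + x $ 4)"
    unfolding inner_vec_def sum_4 tri_form_nth s_def
    by (simp add: power2_eq_square algebra_simps)
  then show ?thesis unfolding 1 2 3[symmetric] by simp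
qed

text \<open>By Tonelli, \<open>nn_integral_quadratic_powr\<close> is used first in \<open>b\<close>,
  then in \<open>a\<close>. Each use lowers the exponent by 1/2 and yields
  \<open>s powr (- 1/2)\<close>; the remaining power of \<open>E24 x / s\<close> supplies
  \<open>s powr \<beta>\<close>.\<close>

lemma nn_integral_tri_form:
  fixes x :: "real^4"
  assumes x: "x \<in> pos_orthant"
  shows "(\<integral>\<^sup>+v. ennreal ((tri_form v \<bullet> x) powr - (\<beta> + 1)) \<partial>(lborel \<Otimes>\<^sub>M lborel))
    = ennreal ((x $ 1 + x $ 2 + x $ 3) powr (\<beta> - 1) * E24 x powr - \<beta>) * (kappa (\<beta> + 1) * kappa (\<beta> + 1/2))"
proof -
  define s A where "s = x $ 1 + x $ 2 + x $ 3" and "A = E24 x / s"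
  have s: "0 < s" using x by (simp add: s_def pos_orthant_def add_pos_pos)
  have A: "0 < A" using s E24_pos[OF x] by (simp add: A_def)
  define B where "B a = s * (a - (x $ 2 + x $ 3 / 2) / s)\<^sup>2 + A" for a
  have B: "0 < B a" for a using s A by (simp add: B_def add_nonneg_pos)
  have [measurable]: "(\<lambda>v. tri_form v \<bullet> x) \<in> borel_measurable (lborel \<Otimes>\<^sub>M lborel)"
    using borel_measurable_inner[OF tri_form_meas borel_measurable_const] by simp
  have outer: "(\<integral>\<^sup>+a. ennreal (B a powr - (\<beta> + 1/2)) \<partial>lborel)
      = ennreal (s powr (- 1/2) * A powr (- \<beta>)) * kappa (\<beta> + 1/2)"
    unfolding B_def by (subst nn_integral_quadratic_powr[OF s A]) simp
  have "(\<integral>\<^sup>+v. ennreal ((tri_form v \<bullet> x) powr - (\<beta> + 1)) \<partial>(lborel \<Otimes>\<^sub>M lborel))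
      = (\<integral>\<^sup>+a. \<integral>\<^sup>+b. ennreal ((tri_form (a, b) \<bullet> x) powr - (\<beta> + 1)) \<partial>lborel \<partial>lborel)"
    by (subst lborel.nn_integral_fst[symmetric]) auto
  also have "\<dots> = (\<integral>\<^sup>+a. ennreal (s powr (- 1/2) * B a powr (1/2 - (\<beta> + 1))) * kappa (\<beta> + 1) \<partial>lborel)"
    unfolding tri_form_inner[OF x] s_def[symmetric] A_def[symmetric] B_def[symmetric]
    by (subst nn_integral_quadratic_powr[OF s B]) (rule refl)
  also have "\<dots> = (\<integral>\<^sup>+a. (ennreal (s powr (- 1/2)) * kappa (\<beta> + 1)) * ennreal (B a powr - (\<beta> + 1/2)) \<partial>lborel)"
    by (simp add: ennreal_mult' ac_simps diff_diff_eq)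
  also have "\<dots> = ennreal (s powr (- 1/2)) * kappa (\<beta> + 1)
      * (ennreal (s powr (- 1/2) * A powr (- \<beta>)) * kappa (\<beta> + 1/2))"
    unfolding outer[symmetric] by (rule nn_integral_cmult) (simp add: B_def)
  also have "\<dots> = ennreal (s powr (- 1/2) * (s powr (- 1/2) * A powr (- \<beta>)))
      * (kappa (\<beta> + 1) * kappa (\<beta> + 1/2))"
    by (simp add: ennreal_mult' ac_simps)
  also have "s powr (- 1/2) * (s powr (- 1/2) * A powr (- \<beta>)) = s powr (\<beta> - 1) * E24 x powr - \<beta>"
  proof -
    have "A powr - \<beta> = E24 x powr - \<beta> * s powr \<beta>"
      using s E24_pos[OF x] by (simp add: A_def powr_divide powr_minus_divide)
    moreover have "s powr (- 1/2) * s powr (- 1/2) * s powr \<beta> = s powr (\<beta> - 1)"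
      using s by (simp add: powr_diff flip: powr_add)
    ultimately show ?thesis by (simp add: ac_simps)
  qed
  finally show ?thesis by (simp add: s_def)
qed

lemma completely_monotone_E24_powr:
  assumes \<beta>: "1 \<le> \<beta>"
  shows "completely_monotone (\<lambda>x. E24 x powr - \<beta>)"
proof -
  interpret neg_power_mixture "lborel \<Otimes>\<^sub>M lborel" tri_form
    by unfold_locales (use tri_form_meas tri_form_nonneg in auto)
  \<comment> \<open>Finiteness of this constant gives integrability, and positivity allows the
    weight \<open>1 / K\<close> below.\<close>
  define K where "K = enn2real (kappa (\<beta> + 1) * kappa (\<beta> + 1/2))"
  have fin: "kappa (\<beta> + 1) * kappa (\<beta> + 1/2) < \<infinity>"
    using kappa_finite[of "\<beta> + 1"] kappa_finite[of "\<beta> + 1/2"] \<beta>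
    by (simp add: ennreal_mult_less_top)
  moreover have "0 < kappa (\<beta> + 1) * kappa (\<beta> + 1/2)"
    using kappa_pos by (simp add: ennreal_zero_less_mult_iff)
  ultimately have K: "0 < K" "ennreal K = kappa (\<beta> + 1) * kappa (\<beta> + 1/2)"
    by (auto simp: K_def enn2real_positive_iff)
  define u :: "real^4" where "u = axis 1 1 + axis 2 1 + axis 3 1"
  have u: "u \<bullet> x = x $ 1 + x $ 2 + x $ 3" for x
    by (simp add: u_def inner_add_left inner_axis')
  have u0: "0 \<le> u $ i" for i by (simp add: u_def axis_def)
  have int: "integrable (lborel \<Otimes>\<^sub>M lborel) (\<lambda>v. (tri_form v \<bullet> x) powr - (\<beta> + 1)) \<and>
      (\<integral>v. (tri_form v \<bullet> x) powr - (\<beta> + 1) \<partial>(lborel \<Otimes>\<^sub>M lborel))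
        = (u \<bullet> x) powr (\<beta> - 1) * E24 x powr - \<beta> * K" if "x \<in> pos_orthant" for x
  proof (subst nn_integral_eq_integrable[symmetric])
    show "(\<integral>\<^sup>+v. ennreal ((tri_form v \<bullet> x) powr - (\<beta> + 1)) \<partial>(lborel \<Otimes>\<^sub>M lborel))
        = ennreal ((u \<bullet> x) powr (\<beta> - 1) * E24 x powr - \<beta> * K)"
      unfolding nn_integral_tri_form[OF that] u K(2)[symmetric]
      using K(1) by (subst ennreal_mult'[symmetric]) auto
  qed (use K in \<open>auto intro!: mult_nonneg_nonneg\<close>)
  have "admissible (\<lambda>_. 1 / K) (\<beta> + 1)"
    using int \<beta> K(1) by (auto simp: admissible_def kernel_def[abs_def])
  \<comment> \<open>Here \<open>1 \<le> \<beta>\<close> enters: the factor with exponent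
    \<open>- (\<beta> - 1)\<close>, which cancels the power of \<open>u \<bullet> x\<close> left by
    the integral, is completely monotone as \<open>\<beta> - 1\<close> is nonnegative.\<close>
  from completely_monotone_mult[OF completely_monotone_linear_powr[OF u0, of "\<beta> - 1" 1]
      completely_monotone_mixture[OF this]]
  have cm: "completely_monotone (\<lambda>x. 1 * (u \<bullet> x) powr - (\<beta> - 1) *
      (\<integral>v. 1 / K * (tri_form v \<bullet> x) powr - (\<beta> + 1) \<partial>(lborel \<Otimes>\<^sub>M lborel)))"
    using \<beta> by simp
  show ?thesis
  proof (rule completely_monotone_cong[OF _ cm])
    fix x :: "real^4" assume x: "x \<in> pos_orthant"
    have "0 < u \<bullet> x" using x by (simp add: u pos_orthant_def add_pos_pos)
    then have "(u \<bullet> x) powr - (\<beta> - 1) * (u \<bullet> x) powr (\<beta> - 1) = 1"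
      by (simp flip: powr_add)
    then show "E24 x powr - \<beta> = 1 * (u \<bullet> x) powr - (\<beta> - 1) *
      (\<integral>v. 1 / K * (tri_form v \<bullet> x) powr - (\<beta> + 1) \<partial>(lborel \<Otimes>\<^sub>M lborel))"
      using int[OF x] K(1) by (simp add: ac_simps)
  qed
qed

text \<open>Both powers are 1 on the orthant, where the bases are positive. The detour through a
  congruence is due to \<open>0 powr 0 = 0\<close>, by which neither is constant on the whole
  space.\<close>

lemma completely_monotone_E24_powr_0: "completely_monotone (\<lambda>x. E24 x powr - 0)"
proof (rule completely_monotone_cong)
  show "completely_monotone (\<lambda>x :: real^4. 1 * (axis 1 1 \<bullet> x) powr - 0)"
    by (rule completely_monotone_linear_powr) (simp_all add: axis_def)
  fix x :: "real^4" assume x: "x \<in> pos_orthant"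
  show "E24 x powr - 0 = 1 * (axis 1 1 \<bullet> x) powr - 0"
    using E24_pos[OF x] pos_orthantD[OF x, of 1] by (simp add: inner_axis')
qed

section \<open>Reflection and Taylor coefficients\<close>

text \<open>Each derivative of the reflected function brings a factor -1 by the chain rule. The
  formula for \<open>is\<close> on a whole neighbourhood gives the derivative for
  \<open>i # is\<close>, which drives the induction.\<close>

lemma iter_partial_reflect:
  fixes f :: "real^'n::finite \<Rightarrow> real"
  assumes S: "open S" and f: "smooth_on_open S f"
  shows "v - y \<in> S \<Longrightarrow> iter_partial is (\<lambda>y. f (v - y)) y = (- 1) ^ length is * iter_partial is f (v - y)"
    and "v - y \<in> S \<Longrightarrow> ((\<lambda>t. iter_partial is (\<lambda>y. f (v - y)) (y + t *\<^sub>R axis i 1))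
      has_real_derivative (- 1) ^ length (i # is) * iter_partial (i # is) f (v - y)) (at 0)"
proof -
  define U where "U = (\<lambda>y. v - y) -` S"
  have U: "open U"
    unfolding U_def by (intro open_vimage S continuous_intros)
  have der: "((\<lambda>t. g (y + t *\<^sub>R axis i 1)) has_real_derivative
      (- 1) ^ length (i # is) * iter_partial (i # is) f (v - y)) (at 0)"
    if g: "\<And>y. y \<in> U \<Longrightarrow> g y = (- 1) ^ length is * iter_partial is f (v - y)" and y: "y \<in> U"
    for g "is" i y
  proof -
    \<comment> \<open>The base point is written \<open>- 0\<close> to match
      \<open>DERIV_mirror\<close>, which reverses the direction of \<open>t\<close>.\<close>
    have "((\<lambda>t. iter_partial is f (v - y + t *\<^sub>R axis i 1)) has_real_derivative
        iter_partial (i # is) f (v - y)) (at (- 0))"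
      using smooth_has_derivative_along[OF f] y by (simp add: U_def)
    then have "((\<lambda>t. iter_partial is f (v - y + (- t) *\<^sub>R axis i 1)) has_real_derivative
        - iter_partial (i # is) f (v - y)) (at 0)"
      unfolding DERIV_mirror by simp
    from DERIV_cmult[OF this, of "(- 1) ^ length is"]
    have "((\<lambda>t. (- 1) ^ length is * iter_partial is f (v - (y + t *\<^sub>R axis i 1))) has_real_derivative
        (- 1) ^ length (i # is) * iter_partial (i # is) f (v - y)) (at 0)"
      by (simp add: algebra_simps)
    then show ?thesis
      by - (rule has_derivative_along_cong[OF U y,
            where g = "\<lambda>y. (- 1) ^ length is * iter_partial is f (v - y)"], rule g)
  qed
  have eq: "iter_partial is (\<lambda>y. f (v - y)) y = (- 1) ^ length is * iter_partial is f (v - y)"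
    if "y \<in> U" for "is" y
    using that
  proof (induction "is" arbitrary: y)
    case (Cons i "is")
    from partial_deriv_eqI[OF der[OF Cons.IH Cons.prems]] show ?case
      by (simp add: iter_partial_Cons)
  qed (simp add: iter_partial_Nil)
  show "v - y \<in> S \<Longrightarrow> iter_partial is (\<lambda>y. f (v - y)) y = (- 1) ^ length is * iter_partial is f (v - y)"
    using eq by (simp add: U_def)
  show "v - y \<in> S \<Longrightarrow> ((\<lambda>t. iter_partial is (\<lambda>y. f (v - y)) (y + t *\<^sub>R axis i 1))
      has_real_derivative (- 1) ^ length (i # is) * iter_partial (i # is) f (v - y)) (at 0)"
    using der[OF eq] by (simp add: U_def)
qed

lemma smooth_on_open_reflect:
  fixes f :: "real^'n::finite \<Rightarrow> real"
  assumes S: "open S" and f: "smooth_on_open S f"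
  shows "smooth_on_open ((\<lambda>y. v - y) -` S) (\<lambda>y. f (v - y))"
  unfolding smooth_on_open_def
proof (intro allI conjI ballI)
  fix "is" :: "'n list"
  have "continuous_on S (iter_partial is f)"
    using f unfolding smooth_on_open_def by blast
  then have "continuous_on ((\<lambda>y. v - y) -` S) (\<lambda>y. iter_partial is f (v - y))"
    by (rule continuous_on_compose2) (auto intro!: continuous_intros)
  then show "continuous_on ((\<lambda>y. v - y) -` S) (iter_partial is (\<lambda>y. f (v - y)))"
    by (rule continuous_on_eq[OF continuous_on_mult_left[where c = "(- 1) ^ length is"]])
      (simp add: iter_partial_reflect(1)[OF S f])
  fix i x assume "x \<in> (\<lambda>y. v - y) -` S"
  then have "v - x \<in> S" by simp
  from iter_partial_reflect(2)[OF S f this]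
  show "(\<lambda>t. iter_partial is (\<lambda>y. f (v - y)) (x + t *\<^sub>R axis i 1)) differentiable (at 0)"
    unfolding real_differentiable_def by (rule exI)
qed

text \<open>The signs from the reflection cancel those in the definition of complete monotonicity,
  so all derivatives at the origin are nonnegative.\<close>

lemma nonneg_taylor_coeffs_completely_monotone:
  fixes f :: "real^'n::{finite,linorder} \<Rightarrow> real"
  assumes f: "completely_monotone f" and v: "v \<in> pos_orthant"
  shows "nonneg_taylor_coeffs (\<lambda>y. f (v - y)) 0"
proof -
  have smooth: "smooth_on_open pos_orthant f"
    using f by (simp add: completely_monotone_def)
  have "open ((\<lambda>y. v - y) -` pos_orthant)"
    by (intro open_vimage open_pos_orthant continuous_intros)
  moreover have "0 \<in> (\<lambda>y. v - y) -` pos_orthant" using v by simp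
  moreover have "0 \<le> iter_partial is (\<lambda>y. f (v - y)) 0" for "is"
    using f v iter_partial_reflect(1)[OF open_pos_orthant smooth, of v 0 "is"]
    by (simp add: completely_monotone_def)
  ultimately show ?thesis
    unfolding nonneg_taylor_coeffs_def taylor_coeff_def
    using smooth_on_open_reflect[OF open_pos_orthant smooth]
    by (blast intro: divide_nonneg_nonneg prod_nonneg fact_ge_zero)
qed

section \<open>Jets and sums over words\<close>

text \<open>When \<open>L m\<close> is the signed derivative of multi-index \<open>m\<close>, this
  is the constant-coefficient differential operator with symbol \<open>sum_k r_k z^(e_k)\<close>.
  Commutative addition of indices makes such operators commute.\<close>

definition shift_sum :: "('k::finite \<Rightarrow> real) \<Rightarrow> ('k \<Rightarrow> 'm::comm_monoid_add) \<Rightarrow> ('m \<Rightarrow> real) \<Rightarrow> 'm \<Rightarrow> real" where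
  "shift_sum r e L m = (\<Sum>k\<in>UNIV. r k * L (m + e k))"

lemma shift_sum_commute:
  "shift_sum r e (shift_sum r' e' L) = shift_sum r' e' (shift_sum r e L)"
proof
  fix m
  have "shift_sum r e (shift_sum r' e' L) m = (\<Sum>k\<in>UNIV. \<Sum>l\<in>UNIV. r k * (r' l * L (m + e k + e' l)))"
    by (simp add: shift_sum_def sum_distrib_left)
  also have "\<dots> = (\<Sum>l\<in>UNIV. \<Sum>k\<in>UNIV. r' l * (r k * L (m + e' l + e k)))"
    by (subst sum.swap) (simp add: ac_simps)
  also have "\<dots> = shift_sum r' e' (shift_sum r e L) m"
    by (simp add: shift_sum_def sum_distrib_left)
  finally show "shift_sum r e (shift_sum r' e' L) m = shift_sum r' e' (shift_sum r e L) m" .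
qed

lemma shift_sum_scale: "shift_sum r e (\<lambda>m. a * L m) = (\<lambda>m. a * shift_sum r e L m)"
  by (simp add: shift_sum_def fun_eq_iff sum_distrib_left mult.left_commute)

lemma shift_sum_add: "shift_sum r e (\<lambda>m. L m + L' m) = (\<lambda>m. shift_sum r e L m + shift_sum r e L' m)"
  by (simp add: shift_sum_def fun_eq_iff sum.distrib distrib_left)

lemma shift_sum_mono:
  assumes "\<And>k. r k \<le> r' k" "\<And>m. 0 \<le> L m"
  shows "shift_sum r e L m \<le> shift_sum r' e L m"
  unfolding shift_sum_def by (intro sum_mono mult_right_mono assms)

lemma shift_sum_nonneg:
  assumes "\<And>k. 0 \<le> r k" "\<And>m. 0 \<le> L m"
  shows "0 \<le> shift_sum r e L m"
  unfolding shift_sum_def by (intro sum_nonneg mult_nonneg_nonneg assms)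

lemma funpow_shift_sum_nonneg:
  assumes "\<And>k. 0 \<le> r k" "\<And>m. 0 \<le> L m"
  shows "0 \<le> (shift_sum r e ^^ n) L m"
  by (induction n arbitrary: m) (simp_all add: assms shift_sum_nonneg)

lemma funpow_shift_sum_commute:
  "shift_sum r e ((shift_sum r' e' ^^ n) L) = (shift_sum r' e' ^^ n) (shift_sum r e L)"
  by (induction n) (simp_all add: shift_sum_commute[of r e])

section \<open>Sums of squares over words\<close>

text \<open>Unfolded, this sums
  \<open>(a + r k_1 + ... + r k_n)^2 * L (m + e k_1 + ... + e k_n)\<close> over all words of length
  \<open>n\<close>; \<open>a\<close> accumulates the weights already read.\<close>

primrec word_square_sum ::
    "('k::finite \<Rightarrow> real) \<Rightarrow> ('k \<Rightarrow> 'm::comm_monoid_add) \<Rightarrow> nat \<Rightarrow> real \<Rightarrow> ('m \<Rightarrow> real) \<Rightarrow> 'm \<Rightarrow> real" where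
  "word_square_sum r e 0 a L m = a\<^sup>2 * L m"
| "word_square_sum r e (Suc n) a L m = (\<Sum>k\<in>UNIV. word_square_sum r e n (a + r k) L (m + e k))"

lemma word_square_sum_nonneg:
  assumes "\<And>m. 0 \<le> L m"
  shows "0 \<le> word_square_sum r e n a L m"
  by (induction n arbitrary: a m) (auto intro!: sum_nonneg mult_nonneg_nonneg assms)

text \<open>For words of length \<open>N = n + 2\<close>, squaring the weight sum gives
  \<open>N\<close> diagonal and \<open>N * (N - 1)\<close> mixed products; as shifts commute,
  products of one kind contribute equally. Starting at length 2 avoids truncated subtraction in the
  powers of \<open>G\<close>.\<close>

lemma word_square_sum_eq:
  fixes r :: "'k::finite \<Rightarrow> real" and e :: "'k \<Rightarrow> 'm::comm_monoid_add"
  defines "G \<equiv> shift_sum (\<lambda>_. 1) e" and "R \<equiv> shift_sum r e" and "S \<equiv> shift_sum (\<lambda>k. (r k)\<^sup>2) e"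
  shows "word_square_sum r e (Suc (Suc n)) a L m =
    a\<^sup>2 * (G ^^ Suc (Suc n)) L m + 2 * a * (real (Suc (Suc n)) * R ((G ^^ Suc n) L) m)
    + (real (Suc (Suc n)) * S ((G ^^ Suc n) L) m
      + real (Suc (Suc n)) * real (Suc n) * R (R ((G ^^ n) L)) m)"
proof -
  \<comment> \<open>This is the effect of prepending one letter on a quadratic polynomial in
    \<open>a\<close> with coefficients \<open>A\<close>, \<open>2 * B\<close>,
    \<open>C\<close>.\<close>
  have expand: "(\<Sum>k\<in>UNIV. (a + r k)\<^sup>2 * A (m + e k) + 2 * (a + r k) * B (m + e k) + C (m + e k))
      = a\<^sup>2 * G A m + 2 * a * (G B m + R A m) + (G C m + 2 * R B m + S A m)" for a A B C m
    unfolding G_def R_def S_def shift_sum_def sum_distrib_left sum.distrib[symmetric]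
    by (intro sum.cong refl) (simp add: power2_eq_square algebra_simps)
  have GR: "G (R A) = R (G A)" for A unfolding G_def R_def by (rule shift_sum_commute)
  have GS: "G (S A) = S (G A)" for A unfolding G_def S_def by (rule shift_sum_commute)
  have Gscale: "G (\<lambda>m. c * A m) = (\<lambda>m. c * G A m)" for c A unfolding G_def by (rule shift_sum_scale)
  have Gadd: "G (\<lambda>m. A m + B m) = (\<lambda>m. G A m + G B m)" for A B unfolding G_def by (rule shift_sum_add)
  have Rscale: "R (\<lambda>m. c * A m) = (\<lambda>m. c * R A m)" for c A unfolding R_def by (rule shift_sum_scale)
  have 1: "word_square_sum r e (Suc 0) a L m = a\<^sup>2 * G L m + 2 * a * R L m + S L m" for a m
    using expand[of a L m "\<lambda>_. 0" "\<lambda>_. 0"] by (simp add: G_def R_def shift_sum_def)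
  show ?thesis
  proof (induction n arbitrary: a m)
    case 0
    show ?case
      unfolding word_square_sum.simps(2)[of r e "Suc 0"] 1
      using expand[of a "G L" m "R L" "S L"] by (simp add: GR GS algebra_simps)
  next
    case (Suc n)
    define A where "A = (G ^^ n) L"
    define N where "N = real (Suc (Suc n))"
    have "word_square_sum r e (Suc (Suc (Suc n))) a L m =
        (\<Sum>k\<in>UNIV. (a + r k)\<^sup>2 * G (G A) (m + e k) + 2 * (a + r k) * (N * R (G A) (m + e k))
          + (N * S (G A) (m + e k) + N * (N - 1) * R (R A) (m + e k)))"
      unfolding word_square_sum.simps(2)[of r e "Suc (Suc n)"] Suc.IH by (simp add: A_def N_def)
    also have "\<dots> = a\<^sup>2 * G (G (G A)) m + 2 * a * (N * R (G (G A)) m + R (G (G A)) m)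
        + ((N * S (G (G A)) m + N * (N - 1) * R (R (G A)) m) + 2 * (N * R (R (G A)) m) + S (G (G A)) m)"
      by (subst expand[of a "G (G A)" m "\<lambda>m. N * R (G A) m"
            "\<lambda>m. N * S (G A) m + N * (N - 1) * R (R A) m"])
        (simp only: Gscale Gadd Rscale GR GS)
    \<comment> \<open>The count of mixed terms grows by
      \<open>N * (N - 1) + 2 * N = (N + 1) * N\<close>.\<close>
    also have "\<dots> = a\<^sup>2 * G (G (G A)) m + 2 * a * ((N + 1) * R (G (G A)) m)
        + ((N + 1) * S (G (G A)) m + (N + 1) * N * R (R (G A)) m)"
      by (simp add: algebra_simps)
    finally show ?case by (simp add: A_def N_def)
  qed
qed

text \<open>An exchangeability argument: summing the squares \<open>(r k\<^sub>1 + \<dots> + r k\<^sub>n)\<^sup>2\<close> over all words of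
  length \<open>n\<close> against the nonnegative function \<open>L\<close>, each of the \<open>n (n - 1)\<close> mixed terms contributes
  \<open>R\<^sup>2 G\<^bsup>n - 2\<^esup>\<close> and each of the \<open>n\<close> diagonal terms \<open>S G\<^bsup>n - 1\<^esup>\<close>.\<close>

lemma shift_sum_square_nonneg:
  fixes r :: "'k::finite \<Rightarrow> real" and e :: "'k \<Rightarrow> 'm::comm_monoid_add"
  assumes "\<And>m. 0 \<le> L m"
  defines "G \<equiv> shift_sum (\<lambda>_. 1) e" and "R \<equiv> shift_sum r e" and "S \<equiv> shift_sum (\<lambda>k. (r k)\<^sup>2) e"
  shows "0 \<le> S ((G ^^ Suc n) L) m + real (Suc n) * R (R ((G ^^ n) L)) m"
proof -
  \<comment> \<open>Starting from \<open>a = 0\<close> leaves two terms with the common factor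
    \<open>n + 2\<close>, which is then divided out.\<close>
  have "0 \<le> real (Suc (Suc n)) * (S ((G ^^ Suc n) L) m + real (Suc n) * R (R ((G ^^ n) L)) m)"
    using word_square_sum_nonneg[of L r e "Suc (Suc n)" 0 m, OF assms(1)]
    unfolding word_square_sum_eq G_def R_def S_def by (simp add: algebra_simps)
  then show ?thesis by (simp add: zero_le_mult_iff)
qed

section \<open>Jets of completely monotone functions\<close>

text \<open>A jet collects the functions \<open>(- 1)\<^bsup>size M\<^esup> \<partial>\<^sup>M f\<close> on the positive orthant.\<close>

definition jet :: "(real^'n::finite \<Rightarrow> 'n multiset \<Rightarrow> real) \<Rightarrow> bool" where
  "jet L \<longleftrightarrow> (\<forall>x\<in>pos_orthant. \<forall>M.
     ((\<lambda>y. L y M) has_derivative (\<lambda>h. - (\<Sum>i\<in>UNIV. h $ i * L x (M + {#i#})))) (at x))"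

text \<open>Symmetry of mixed partials makes the ordering of each multiset chosen by
  \<open>list\<close> immaterial, and \<open>has_derivative_partials\<close> upgrades coordinate
  derivatives to total ones, so the diagonal direction becomes available.\<close>

lemma completely_monotone_imp_jet:
  fixes f :: "real^'n::finite \<Rightarrow> real"
  assumes f: "completely_monotone f"
  obtains L where "jet L" "\<And>x. L x {#} = f x" "\<And>x M. x \<in> pos_orthant \<Longrightarrow> 0 \<le> L x M"
proof
  have smooth: "smooth_on_open pos_orthant f"
    using f by (simp add: completely_monotone_def)
  define list where "list M = (SOME is. mset is = M)" for M :: "'n multiset"
  have list: "mset (list M) = M" for M
    unfolding list_def by (rule someI_ex) (rule ex_mset)
  have len: "length (list M) = size M" for M
    using list[of M] by (metis size_mset)
  define L where "L x M = (- 1) ^ size M * iter_partial (list M) f x" for x M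
  show "L x {#} = f x" for x
    using list[of "{#}"] by (simp add: L_def iter_partial_Nil)
  show "0 \<le> L x M" if "x \<in> pos_orthant" for x M
    using f that by (simp add: L_def completely_monotone_def flip: len)
  show "jet L"
    unfolding jet_def
  proof (intro ballI allI)
    fix x :: "real^'n" and M :: "'n multiset" assume x: "x \<in> pos_orthant"
    have "((iter_partial (list M) f) has_derivative
        (\<lambda>h. \<Sum>i\<in>UNIV. h $ i * iter_partial (i # list M) f x)) (at x)"
      using smooth
      by (intro has_derivative_partials[OF open_pos_orthant x] smooth_has_derivative_along[OF smooth])
        (simp_all add: smooth_on_open_def)
    moreover have "iter_partial (i # list M) f x = iter_partial (list (M + {#i#})) f x" for i
      by (rule iter_partial_mset_eq[OF open_pos_orthant smooth _ x]) (simp add: list)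
    ultimately have "((iter_partial (list M) f) has_derivative
        (\<lambda>h. \<Sum>i\<in>UNIV. h $ i * iter_partial (list (M + {#i#})) f x)) (at x)"
      by simp
    from has_derivative_mult_right[OF this, of "(- 1) ^ size M"]
    show "((\<lambda>y. L y M) has_derivative (\<lambda>h. - (\<Sum>i\<in>UNIV. h $ i * L x (M + {#i#})))) (at x)"
      by (simp add: L_def sum_distrib_left sum_negf mult.left_commute)
  qed
qed

lemma jet_shift_sum:
  fixes L :: "real^'n::finite \<Rightarrow> 'n multiset \<Rightarrow> real"
  assumes "jet L"
  shows "jet (\<lambda>x. shift_sum r e (L x))"
  unfolding jet_def shift_sum_def
proof (intro ballI allI)
  fix x :: "real^'n" and M assume x: "x \<in> pos_orthant"
  have "((\<lambda>y. \<Sum>k\<in>UNIV. r k * L y (M + e k)) has_derivative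
      (\<lambda>h. \<Sum>k\<in>UNIV. r k * - (\<Sum>i\<in>UNIV. h $ i * L x (M + e k + {#i#})))) (at x)"
    using assms x unfolding jet_def
    by (intro has_derivative_sum has_derivative_mult_right) blast
  also have "(\<lambda>h. \<Sum>k\<in>UNIV. r k * - (\<Sum>i\<in>UNIV. h $ i * L x (M + e k + {#i#})))
      = (\<lambda>h. - (\<Sum>i\<in>UNIV. h $ i * (\<Sum>k\<in>UNIV. r k * L x (M + {#i#} + e k))))"
    unfolding sum_distrib_left sum_negf[symmetric] mult_minus_right
    by (subst sum.swap) (simp add: ac_simps)
  finally show "((\<lambda>y. \<Sum>k\<in>UNIV. r k * L y (M + e k)) has_derivative
      (\<lambda>h. - (\<Sum>i\<in>UNIV. h $ i * (\<Sum>k\<in>UNIV. r k * L x (M + {#i#} + e k))))) (at x)" .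
qed

lemma jet_along:
  assumes "jet L" "x + t0 *\<^sub>R v \<in> pos_orthant"
  shows "((\<lambda>t. L (x + t *\<^sub>R v) M) has_real_derivative
    - (\<Sum>i\<in>UNIV. v $ i * L (x + t0 *\<^sub>R v) (M + {#i#}))) (at t0)"
proof -
  have "((\<lambda>t. x + t *\<^sub>R v) has_derivative (\<lambda>h. h *\<^sub>R v)) (at t0)"
    by (auto intro!: derivative_eq_intros)
  moreover have "((\<lambda>y. L y M) has_derivative
      (\<lambda>h. - (\<Sum>i\<in>UNIV. h $ i * L (x + t0 *\<^sub>R v) (M + {#i#})))) (at (x + t0 *\<^sub>R v))"
    using assms unfolding jet_def by blast
  ultimately have "((\<lambda>t. L (x + t *\<^sub>R v) M) has_derivative
      (\<lambda>h. - (\<Sum>i\<in>UNIV. (h *\<^sub>R v) $ i * L (x + t0 *\<^sub>R v) (M + {#i#})))) (at t0)"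
    by (rule has_derivative_compose)
  moreover have "(\<lambda>h. - (\<Sum>i\<in>UNIV. (h *\<^sub>R v) $ i * L (x + t0 *\<^sub>R v) (M + {#i#})))
      = (*) (- (\<Sum>i\<in>UNIV. v $ i * L (x + t0 *\<^sub>R v) (M + {#i#})))"
    by (auto simp: fun_eq_iff sum_distrib_left mult_ac)
  ultimately show ?thesis
    by (simp only: has_field_derivative_def)
qed

lemma jet_axis:
  assumes "jet L" "x \<in> pos_orthant"
  shows "((\<lambda>t. L (x + t *\<^sub>R axis i 1) M) has_real_derivative - L x (M + {#i#})) (at 0)"
  using jet_along[of L x 0 "axis i 1" M] assms
  by (simp add: axis_def if_distrib if_distribR cong: if_cong)

abbreviation diagonal :: "real \<Rightarrow> real^'n::finite" where
  "diagonal t \<equiv> t *\<^sub>R (\<chi> i. 1)"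

lemma diagonal_pos: "0 < t \<Longrightarrow> diagonal t \<in> pos_orthant"
  by (simp add: pos_orthant_def)

text \<open>The all-ones direction is tangent to the diagonal, so there the sum of the signed
  partials is \<open>- d/dt\<close> and only values on the diagonal matter. Each step multiplies by
  the current exponent, which builds the rising factorial; \<open>L\<close> is generalized since the
  step passes to another jet.\<close>

lemma jet_diagonal_power:
  assumes "jet L" and "\<And>t. 0 < t \<Longrightarrow> L (diagonal t) {#} = C * t powr - g" and "0 < t"
  shows "(shift_sum (\<lambda>_. 1) (\<lambda>i. {#i#}) ^^ n) (L (diagonal t)) {#}
    = C * pochhammer g n * t powr - (g + n)"
  using assms
proof (induction n arbitrary: L C g t)
  case (Suc n)
  let ?D = "shift_sum (\<lambda>_. 1) (\<lambda>i. {#i#})"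
  have base: "?D (L (diagonal t)) {#} = C * g * t powr - (g + 1)" if t: "0 < t" for t
  proof -
    have "((\<lambda>t. L (diagonal t) {#}) has_real_derivative - ?D (L (diagonal t)) {#}) (at t)"
      using jet_along[OF Suc.prems(1), of 0 t "\<chi> i. 1" "{#}"] diagonal_pos[OF t]
      by (simp add: shift_sum_def)
    moreover have "((\<lambda>t. L (diagonal t) {#}) has_real_derivative - (C * g * t powr - (g + 1))) (at t)"
    proof -
      have "((\<lambda>t. C * t powr - g) has_real_derivative - (C * g * t powr - (g + 1))) (at t)"
        using DERIV_cmult[OF DERIV_fun_powr[OF DERIV_ident t, of "- g"], of C] by (simp add: mult_ac)
      moreover have "\<forall>\<^sub>F t in nhds t. L (diagonal t) {#} = C * t powr - g"
        using eventually_nhds_in_open[of "{0<..}" t] t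
        by (auto elim!: eventually_mono intro: Suc.prems(2))
      ultimately show ?thesis by (subst DERIV_cong_ev[OF refl _ refl]) auto
    qed
    ultimately show ?thesis using DERIV_unique by fastforce
  qed
  have "(?D ^^ Suc n) (L (diagonal t)) {#} = (?D ^^ n) (?D (L (diagonal t))) {#}"
    by (simp add: funpow_Suc_right del: funpow.simps)
  also have "\<dots> = C * g * pochhammer (g + 1) n * t powr - (g + 1 + n)"
    by (rule Suc.IH[OF jet_shift_sum[OF Suc.prems(1)] base Suc.prems(3)])
  finally show ?case by (simp add: pochhammer_rec add_ac mult_ac)
qed simp

section \<open>Failure below one\<close>

text \<open>The quadratic form with these weights is, up to a factor, the inverse of the form \<^const>\<open>E24\<close>.\<close>

definition dual_weight :: "4 \<times> 4 \<Rightarrow> real" where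
  "dual_weight k = (if fst k = snd k then -2 else 1)"

abbreviation pair :: "4 \<times> 4 \<Rightarrow> 4 multiset" where
  "pair k \<equiv> {#fst k, snd k#}"

lemma sum_4_4: "(\<Sum>k\<in>UNIV. F k) = (\<Sum>i\<in>(UNIV :: 4 set). \<Sum>j\<in>(UNIV :: 4 set). F (i, j))"
  by (simp add: sum.cartesian_product UNIV_Times_UNIV)

text \<open>\<open>E24\<close> has degree one in each variable, hence no term in
  \<open>t^2\<close>.\<close>

lemma E24_along_axis:
  "E24 (x + t *\<^sub>R axis i 1) = E24 x + t * ((\<Sum>j\<in>UNIV. x $ j) - x $ i)"
  using exhaust_4[of i] by (auto simp: E24_def sum_4 axis_def algebra_simps)

lemma has_derivative_E24_powr:
  assumes "x \<in> pos_orthant"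
  shows "((\<lambda>t. E24 (x + t *\<^sub>R axis i 1) powr a) has_real_derivative
    a * E24 x powr (a - 1) * ((\<Sum>j\<in>UNIV. x $ j) - x $ i)) (at 0)"
proof -
  let ?\<sigma> = "(\<Sum>j\<in>UNIV. x $ j) - x $ i"
  have "((\<lambda>t. E24 x + t * ?\<sigma>) has_real_derivative ?\<sigma>) (at 0)"
    by (auto intro!: derivative_eq_intros)
  from DERIV_fun_powr[OF this, of a] show ?thesis
    unfolding E24_along_axis using E24_pos[OF assms] by simp
qed

text \<open>With \<open>\<sigma> i\<close> the partial derivatives of \<open>E24\<close>, the
  weighted sum of \<open>\<sigma> i * \<sigma> j\<close> is \<open>6 * E24\<close> and that of the
  mixed second derivatives of \<open>E24\<close> is 12, so the factor is
  \<open>6 * (g + 1) - 12\<close>. The constant \<open>c\<close> permits a second application to the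
  result.\<close>

lemma jet_E24_powr:
  assumes L: "jet L" and base: "\<And>x. x \<in> pos_orthant \<Longrightarrow> L x {#} = c * E24 x powr - g"
    and x: "x \<in> pos_orthant"
  shows "shift_sum dual_weight pair (L x) {#} = 6 * c * g * (g - 1) * E24 x powr - (g + 1)"
proof -
  define \<sigma> where "\<sigma> i y = (\<Sum>j\<in>UNIV. y $ j) - y $ i" for i :: 4 and y :: "real^4"
  have dE: "((\<lambda>t. E24 (y + t *\<^sub>R axis i 1) powr a) has_real_derivative a * E24 y powr (a - 1) * \<sigma> i y) (at 0)"
    if "y \<in> pos_orthant" for y i a
    unfolding \<sigma>_def by (rule has_derivative_E24_powr[OF that])
  have d\<sigma>: "\<sigma> i (y + t *\<^sub>R axis j 1) = \<sigma> i y + t * (if i = j then 0 else 1)" for i j y t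
    using exhaust_4[of i] exhaust_4[of j] by (auto simp: \<sigma>_def sum_4 axis_def)
  have first: "L y {#i#} = c * g * (E24 y powr - (g + 1) * \<sigma> i y)" if y: "y \<in> pos_orthant" for y i
  proof -
    have "((\<lambda>t. L (y + t *\<^sub>R axis i 1) {#}) has_real_derivative
        c * (- g * E24 y powr (- g - 1) * \<sigma> i y)) (at 0)"
      by (rule has_derivative_along_cong[where f = "\<lambda>y. L y {#}" and g = "\<lambda>y. c * E24 y powr - g",
            OF open_pos_orthant y base DERIV_cmult[OF dE[OF y]]])
    from DERIV_unique[OF this jet_axis[OF L y]] show ?thesis by (simp add: mult_ac)
  qed
  have second: "L x {#i, j#} = c * g * ((g + 1) * E24 x powr - (g + 2) * (\<sigma> i x * \<sigma> j x)
      - E24 x powr - (g + 1) * (if i = j then 0 else 1))" for i j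
  proof -
    have "((\<lambda>t. \<sigma> i (x + t *\<^sub>R axis j 1)) has_real_derivative (if i = j then 0 else 1)) (at 0)"
      unfolding d\<sigma> by (auto intro!: derivative_eq_intros)
    from DERIV_cmult[OF DERIV_mult[OF dE[OF x, of j "- (g + 1)"] this], of "c * g"]
    have "((\<lambda>t. L (x + t *\<^sub>R axis j 1) {#i#}) has_real_derivative
        c * g * (- (g + 1) * E24 x powr (- (g + 1) - 1) * \<sigma> j x * \<sigma> i x
          + (if i = j then 0 else 1) * E24 x powr - (g + 1))) (at 0)"
      by - (rule has_derivative_along_cong[where f = "\<lambda>y. L y {#i#}"
            and g = "\<lambda>y. c * g * (E24 y powr - (g + 1) * \<sigma> i y)", OF open_pos_orthant x first],
          simp_all)
    from DERIV_unique[OF this jet_axis[OF L x]]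
    have "L x {#i, j#} = - (c * g * (- (g + 1) * E24 x powr (- (g + 1) - 1) * \<sigma> j x * \<sigma> i x
          + (if i = j then 0 else 1) * E24 x powr - (g + 1)))"
      by (simp add: add_mset_commute)
    moreover have "- (g + 1) - 1 = - (g + 2)" by simp
    ultimately show ?thesis by (simp only:) (simp add: algebra_simps)
  qed
  have "shift_sum dual_weight pair (L x) {#} =
      c * g * ((g + 1) * E24 x powr - (g + 2) * (\<Sum>k\<in>UNIV. dual_weight k * (\<sigma> (fst k) x * \<sigma> (snd k) x))
        - E24 x powr - (g + 1) * (\<Sum>k\<in>UNIV. dual_weight k * (if fst k = snd k then 0 else 1)))"
    unfolding shift_sum_def second add_0 sum_distrib_left sum_subtractf[symmetric]
    by (intro sum.cong refl) (simp add: second right_diff_distrib mult_ac)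
  also have "(\<Sum>k\<in>UNIV. dual_weight k * (\<sigma> (fst k) x * \<sigma> (snd k) x)) = 6 * E24 x"
    by (simp add: sum_4_4 sum_4 dual_weight_def \<sigma>_def E24_def algebra_simps)
  also have "(\<Sum>k\<in>UNIV. dual_weight k * (if fst k = snd k then 0 else 1)) = 12"
    by (simp add: sum_4_4 sum_4 dual_weight_def)
  also have "(g + 1) * E24 x powr - (g + 2) * (6 * E24 x) = 6 * (g + 1) * E24 x powr - (g + 1)"
  proof -
    have "- (g + 1) = - (g + 2) + 1" by simp
    then have "E24 x powr - (g + 1) = E24 x powr - (g + 2) * E24 x"
      using E24_pos[OF x] by (simp only: powr_add) simp
    then show ?thesis by simp
  qed
  finally show ?thesis by (simp add: algebra_simps)
qed

lemma not_completely_monotone_E24_powr: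
  assumes \<beta>: "0 < \<beta>" "\<beta> < 1"
  shows "\<not> completely_monotone (\<lambda>x. E24 x powr - \<beta>)"
proof
  assume "completely_monotone (\<lambda>x. E24 x powr - \<beta>)"
  from completely_monotone_imp_jet[OF this] obtain L where L: "jet L"
    and base: "\<And>x. L x {#} = E24 x powr - \<beta>" and nonneg: "\<And>x M. x \<in> pos_orthant \<Longrightarrow> 0 \<le> L x M"
    by metis
  define R where "R = shift_sum dual_weight pair"
  define D where "D = shift_sum (\<lambda>_. 1) (\<lambda>i :: 4. {#i#})"
  define G where "G = shift_sum (\<lambda>_. 1) pair"
  \<comment> \<open>The coefficient after two applications of \<open>jet_E24_powr\<close>, with
    \<open>(c, g)\<close> equal to \<open>(1, \<beta>)\<close> and then
    \<open>(6 * \<beta> * (\<beta> - 1), \<beta> + 1)\<close>.\<close>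
  define c where "c = 6 * (6 * \<beta> * (\<beta> - 1)) * (\<beta> + 1) * \<beta>"
  define u :: "real^4" where "u = diagonal 1"
  have u: "u \<in> pos_orthant" unfolding u_def by (rule diagonal_pos) simp
  have c: "c < 0" using \<beta> by (simp add: c_def mult_pos_neg mult_neg_pos)
  have R1: "R (L x) {#} = 6 * \<beta> * (\<beta> - 1) * E24 x powr - (\<beta> + 1)" if "x \<in> pos_orthant" for x
    using jet_E24_powr[OF L, of 1 \<beta>, OF _ that] base by (simp add: R_def)
  have R2: "R (R (L x)) {#} = c * E24 x powr - (\<beta> + 2)" if "x \<in> pos_orthant" for x
    using jet_E24_powr[OF jet_shift_sum[OF L], OF R1[unfolded R_def] that]
    by (simp add: R_def c_def add.assoc)
  have diag: "E24 (diagonal t) powr - g = 6 powr - g * t powr - (2 * g)" if "0 < t" for t g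
  proof -
    have "E24 (diagonal t) = 6 * t\<^sup>2"
      by (simp add: E24_def power2_eq_square)
    moreover have "t\<^sup>2 powr - g = t powr (2 * - g)"
      using that powr_powr[of t 2 "- g"] by simp
    ultimately show ?thesis by (simp add: powr_mult)
  qed
  \<comment> \<open>Summing over ordered pairs of indices squares the operator
    \<open>D\<close>.\<close>
  have G: "G = (\<lambda>A. D (D A))"
    by (intro ext, simp add: G_def D_def shift_sum_def sum_4_4 add.assoc) (rule sum.swap)
  have Gn: "(G ^^ n) A = (D ^^ (2 * n)) A" for n A
    by (induction n) (simp_all add: G)
  have DL: "(D ^^ n) (L u) {#} = 6 powr - \<beta> * pochhammer (2 * \<beta>) n" for n
    using jet_diagonal_power[OF L, of "6 powr - \<beta>" "2 * \<beta>" 1 n] diag base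
    by (simp add: D_def u_def)
  have DRL: "(D ^^ n) (R (R (L u))) {#} = c * 6 powr - (\<beta> + 2) * pochhammer (2 * \<beta> + 4) n" for n
  proof -
    have "R (R (L (diagonal t))) {#} = c * 6 powr - (\<beta> + 2) * t powr - (2 * \<beta> + 4)" if "0 < t" for t
      using R2[OF diagonal_pos[OF that]] diag[OF that, of "\<beta> + 2"] by (simp add: distrib_left)
    from jet_diagonal_power[OF jet_shift_sum[OF jet_shift_sum[OF L]] this[unfolded R_def], of 1 n]
    show ?thesis by (simp add: D_def u_def R_def)
  qed
  \<comment> \<open>The 4 bounds the squared weights; the Pochhammer symbol holds the first four of
    the \<open>2 * n + 4\<close> factors produced by \<open>G ^^ Suc (Suc n)\<close>.\<close>
  define a where "a = 4 * 6 powr - \<beta> * pochhammer (2 * \<beta>) 4"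
  define b where "b = - (c * 6 powr - (\<beta> + 2))"
  have b: "0 < b" using c by (simp add: b_def mult_neg_pos)
  \<comment> \<open>Both terms of the square inequality at \<open>u\<close> carry the same positive
    factor \<open>pochhammer (2 * \<beta> + 4) (2 * n)\<close>. Dividing it out leaves a bound by a
    constant, impossible for large \<open>n\<close>.\<close>
  have "real (Suc n) * b \<le> a" for n
  proof -
    have Lu: "0 \<le> L u M" for M using nonneg[OF u] .
    have "0 \<le> shift_sum (\<lambda>k. (dual_weight k)\<^sup>2) pair ((G ^^ Suc n) (L u)) {#}
        + real (Suc n) * R (R ((G ^^ n) (L u))) {#}"
      unfolding G_def R_def by (rule shift_sum_square_nonneg[OF Lu])
    also have "shift_sum (\<lambda>k. (dual_weight k)\<^sup>2) pair ((G ^^ Suc n) (L u)) {#}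
        \<le> shift_sum (\<lambda>_. 4) pair ((G ^^ Suc n) (L u)) {#}"
      unfolding G_def
      by (intro shift_sum_mono funpow_shift_sum_nonneg Lu) (simp_all add: dual_weight_def)
    also have "\<dots> = 4 * (G ^^ Suc (Suc n)) (L u) {#}"
      by (simp add: G_def shift_sum_def sum_distrib_left)
    also have "\<dots> = a * pochhammer (2 * \<beta> + 4) (2 * n)"
    proof -
      have "2 * Suc (Suc n) = 4 + 2 * n" by simp
      then show ?thesis
        unfolding Gn DL a_def using pochhammer_product'[of "2 * \<beta>" 4 "2 * n"] by (simp only:) simp
    qed
    also have "R (R ((G ^^ n) (L u))) {#} = (G ^^ n) (R (R (L u))) {#}"
      unfolding R_def G_def by (simp add: funpow_shift_sum_commute)
    also have "\<dots> = - b * pochhammer (2 * \<beta> + 4) (2 * n)"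
      unfolding Gn DRL b_def by simp
    finally have "0 \<le> (a - real (Suc n) * b) * pochhammer (2 * \<beta> + 4) (2 * n)"
      by (simp add: algebra_simps)
    moreover have "0 < pochhammer (2 * \<beta> + 4) (2 * n)"
      using \<beta> by (intro pochhammer_pos) simp
    ultimately show ?thesis by (simp add: zero_le_mult_iff)
  qed
  moreover obtain n where "a < real n * b" using reals_Archimedean3[OF b] by blast
  ultimately show False
    using b by (smt (verit, best) mult_right_mono of_nat_Suc)
qed

text \<open>A positive power of \<open>E24\<close> increases in \<open>x_1\<close>, against the sign
  required of a first derivative.\<close>

lemma not_completely_monotone_E24_powr_neg:
  assumes "\<beta> < 0"
  shows "\<not> completely_monotone (\<lambda>x. E24 x powr - \<beta>)"
proof
  assume cm: "completely_monotone (\<lambda>x. E24 x powr - \<beta>)"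
  define u :: "real^4" where "u = diagonal 1"
  have u: "u \<in> pos_orthant" unfolding u_def by (rule diagonal_pos) simp
  have "partial_deriv 1 (\<lambda>x. E24 x powr - \<beta>) u
      = - \<beta> * E24 u powr (- \<beta> - 1) * ((\<Sum>j\<in>UNIV. u $ j) - u $ 1)"
    by (rule partial_deriv_eqI[OF has_derivative_E24_powr[OF u]])
  moreover have "0 < - \<beta> * E24 u powr (- \<beta> - 1) * ((\<Sum>j\<in>UNIV. u $ j) - u $ 1)"
    using assms E24_pos[OF u] by (simp add: u_def sum_4 mult_neg_pos)
  ultimately show False
    using completely_monotoneD(2)[OF completely_monotone_neg_partial[OF cm, of 1] u] by simp
qed

theorem corollary1p6:
  fixes \<beta> :: real
  shows "(completely_monotone (\<lambda>x :: real^4. E24 x powr (- \<beta>)) \<longleftrightarrow> \<beta> = 0 \<or> \<beta> \<ge> 1) \<and>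
         (\<beta> \<ge> 1 \<longrightarrow> nonneg_taylor_coeffs (\<lambda>y :: real^4. E24 (\<chi> i. 1 - y $ i) powr (- \<beta>)) 0)"
proof (intro conjI impI)
  show "completely_monotone (\<lambda>x :: real^4. E24 x powr (- \<beta>)) \<longleftrightarrow> \<beta> = 0 \<or> \<beta> \<ge> 1"
    using completely_monotone_E24_powr[of \<beta>] completely_monotone_E24_powr_0
      not_completely_monotone_E24_powr[of \<beta>] not_completely_monotone_E24_powr_neg[of \<beta>]
    by (cases "\<beta> = 0"; cases "\<beta> < 0"; cases "\<beta> < 1") auto
  assume "\<beta> \<ge> 1"
  have "(\<chi> i. 1 - y $ i) = (\<chi> i. 1) - y" for y :: "real^4"
    by (simp add: vec_eq_iff)
  moreover have "(\<chi> i. 1) \<in> (pos_orthant :: (real^4) set)"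
    by (simp add: pos_orthant_def)
  ultimately show "nonneg_taylor_coeffs (\<lambda>y :: real^4. E24 (\<chi> i. 1 - y $ i) powr (- \<beta>)) 0"
    using nonneg_taylor_coeffs_completely_monotone[OF completely_monotone_E24_powr[OF \<open>\<beta> \<ge> 1\<close>]]
    by simp
qed

end
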